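(* Let $(\lambda,\kappa)\in(\mathbb{R}\setminus\{0\})\times\mathbb{R}$ and let $(u,\rho)$ be a solution of the initial boundary value problem $$u_{xt}+uu_{xx}-\lambda u_x^2-\kappa\rho^2=I(t),\qquad \rho_t+u\rho_x=2\lambda\rho u_x,\qquad t>0,\ x\in[0,1],$$ $$I(t)=-\kappa\int_0^1\rho^2\,dx-(1+\lambda)\int_0^1u_x^2\,dx,$$ with $u(x,0)=u_0(x)$, $\rho(x,0)=\rho_0(x)$ and periodic boundary conditions $u(0,t)=u(1,t)$, $u_x(0,t)=u_x(1,t)$, $\rho(0,t)=\rho(1,t)$. Let $\gamma$ be defined by $\dot\gamma(\alpha,t)=u(\gamma(\alpha,t),t)$, $\gamma(\alpha,0)=\alpha$. Set $$C(\alpha)=\lambda\big(\lambda u_0'(\alpha)^2-\kappa\rho_0(\alpha)^2\big),\qquad \mathcal{Q}(\alpha,t)=C(\alpha)\eta(t)^2-2\lambda u_0'(\alpha)\eta(t)+1,\qquad \bar{\mathcal{P}}_0(t)=\int_0^1\mathcal{Q}(\alpha,t)^{-\frac{1}{2\lambda}}\,d\alpha,$$ where the strictly increasing function $\eta$ satisfies $\dot\eta(t)=\bar{\mathcal{P}}_0(t)^{-2\lambda}$, $\eta(0)=0$. Then, for as long as these quantities are defined (with $\mathcal{Q}(\cdot,t)>0$ on $[0,1]$), for all $\alpha\in[0,1]$, $$\gamma_\alpha(\alpha,t)=\frac{\mathcal{Q}(\alpha,t)^{-\frac{1}{2\lambda}}}{\bar{\mathcal{P}}_0(t)},$$ $$u_x(\gamma(\alpha,t),t)=\frac{\bar{\mathcal{P}}_0(t)^{-2\lambda}}{\lambda}\left\{\frac{\lambda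 u_0'(\alpha)-\eta(t)C(\alpha)}{\mathcal{Q}(\alpha,t)}-\frac{1}{\bar{\mathcal{P}}_0(t)}\int_0^1\frac{\lambda u_0'(\alpha)-\eta(t)C(\alpha)}{\mathcal{Q}(\alpha,t)^{1+\frac{1}{2\lambda}}}\,d\alpha\right\},$$ $$\rho(\gamma(\alpha,t),t)=\frac{\rho_0(\alpha)}{\mathcal{Q}(\alpha,t)}\left(\int_0^1\frac{d\alpha}{\mathcal{Q}(\alpha,t)^{\frac{1}{2\lambda}}}\right)^{-2\lambda}.$$
   Context: Here $\dot{}=\frac{d}{dt}$, $'$ denotes the derivative of the initial datum, and $\gamma_\alpha=\partial\gamma/\partial\alpha$ is the jacobian of the characteristic map. Integrals over $\alpha$ on the right-hand sides use $\alpha$ as a dummy variable. *)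

theory Defs
  imports "HOL-Analysis.Analysis"
begin

text \<open>
  The unknowns live on \<open>[0,1]\<close>. Since \<open>u(0,t) = u(1,t)\<close> need not vanish, characteristics may
  leave \<open>[0,1]\<close>, so along characteristics functions of \<open>x\<close> are read as their 1-periodic extensions.
\<close>

definition periodic_ext :: "(real \<Rightarrow> real \<Rightarrow> real) \<Rightarrow> real \<Rightarrow> real \<Rightarrow> real" where
  "periodic_ext f x t = f (frac x) t"

definition nonlocal_term ::
    "real \<Rightarrow> real \<Rightarrow> (real \<Rightarrow> real \<Rightarrow> real) \<Rightarrow> (real \<Rightarrow> real \<Rightarrow> real) \<Rightarrow> real \<Rightarrow> real" where
  "nonlocal_term lam kap ux \<rho> t =
     - kap * integral {0..1} (\<lambda>x. (\<rho> x t)\<^sup>2) - (1 + lam) * integral {0..1} (\<lambda>x. (ux x t)\<^sup>2)"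

text \<open>
  Classical solutions on \<open>[0,1] \<times> [0,T)\<close>: \<open>u\<close>, \<open>u_x\<close>, \<open>\<rho>\<close> are continuous up to \<open>t = 0\<close>; the
  remaining derivatives in the system exist and are continuous for \<open>t > 0\<close> (one-sided at the
  spatial endpoints). The argument \<open>ux\<close> is the derivative \<open>u_x\<close>.
\<close>

definition classical_solution ::
    "real \<Rightarrow> real \<Rightarrow> real \<Rightarrow> (real \<Rightarrow> real) \<Rightarrow> (real \<Rightarrow> real) \<Rightarrow>
     (real \<Rightarrow> real \<Rightarrow> real) \<Rightarrow> (real \<Rightarrow> real \<Rightarrow> real) \<Rightarrow> (real \<Rightarrow> real \<Rightarrow> real) \<Rightarrow> bool" where
  "classical_solution lam kap T u0 \<rho>0 u ux \<rho> \<longleftrightarrow>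
     continuous_on ({0..1} \<times> {0..<T}) (\<lambda>(x, t). u x t) \<and>
     continuous_on ({0..1} \<times> {0..<T}) (\<lambda>(x, t). ux x t) \<and>
     continuous_on ({0..1} \<times> {0..<T}) (\<lambda>(x, t). \<rho> x t) \<and>
     (\<forall>t\<in>{0..<T}. \<forall>x\<in>{0..1}. ((\<lambda>y. u y t) has_real_derivative ux x t) (at x within {0..1})) \<and>
     (\<exists>uxx uxt \<rho>x \<rho>t.
        continuous_on ({0..1} \<times> {0<..<T}) (\<lambda>(x, t). uxx x t) \<and>
        continuous_on ({0..1} \<times> {0<..<T}) (\<lambda>(x, t). uxt x t) \<and>
        continuous_on ({0..1} \<times> {0<..<T}) (\<lambda>(x, t). \<rho>x x t) \<and>
        continuous_on ({0..1} \<times> {0<..<T}) (\<lambda>(x, t). \<rho>t x t) \<and>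
        (\<forall>t\<in>{0<..<T}. \<forall>x\<in>{0..1}.
           ((\<lambda>y. ux y t) has_real_derivative uxx x t) (at x within {0..1}) \<and>
           ((\<lambda>s. ux x s) has_real_derivative uxt x t) (at t) \<and>
           ((\<lambda>y. \<rho> y t) has_real_derivative \<rho>x x t) (at x within {0..1}) \<and>
           ((\<lambda>s. \<rho> x s) has_real_derivative \<rho>t x t) (at t) \<and>
           uxt x t + u x t * uxx x t - lam * (ux x t)\<^sup>2 - kap * (\<rho> x t)\<^sup>2
             = nonlocal_term lam kap ux \<rho> t \<and>
           \<rho>t x t + u x t * \<rho>x x t = 2 * lam * \<rho> x t * ux x t)) \<and>
     (\<forall>x\<in>{0..1}. u x 0 = u0 x \<and> \<rho> x 0 = \<rho>0 x) \<and>
     (\<forall>t\<in>{0..<T}. u 0 t = u 1 t \<and> ux 0 t = ux 1 t \<and> \<rho> 0 t = \<rho> 1 t)"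

definition characteristic_map ::
    "real \<Rightarrow> (real \<Rightarrow> real \<Rightarrow> real) \<Rightarrow> (real \<Rightarrow> real \<Rightarrow> real) \<Rightarrow> bool" where
  "characteristic_map T u \<gamma> \<longleftrightarrow>
     (\<forall>\<alpha>\<in>{0..1}. \<gamma> \<alpha> 0 = \<alpha> \<and>
       (\<forall>t\<in>{0..<T}. ((\<lambda>s. \<gamma> \<alpha> s) has_real_derivative periodic_ext u (\<gamma> \<alpha> t) t)
          (at t within {0..<T})))"

text \<open>In the following, \<open>du0\<close> stands for the derivative of the initial datum \<open>u0\<close>.\<close>

definition C_coeff ::
    "real \<Rightarrow> real \<Rightarrow> (real \<Rightarrow> real) \<Rightarrow> (real \<Rightarrow> real) \<Rightarrow> real \<Rightarrow> real" where
  "C_coeff lam kap du0 \<rho>0 \<alpha> = lam * (lam * (du0 \<alpha>)\<^sup>2 - kap * (\<rho>0 \<alpha>)\<^sup>2)"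

definition Q_fun ::
    "real \<Rightarrow> real \<Rightarrow> (real \<Rightarrow> real) \<Rightarrow> (real \<Rightarrow> real) \<Rightarrow> (real \<Rightarrow> real) \<Rightarrow> real \<Rightarrow> real \<Rightarrow> real" where
  "Q_fun lam kap du0 \<rho>0 \<eta> \<alpha> t =
     C_coeff lam kap du0 \<rho>0 \<alpha> * (\<eta> t)\<^sup>2 - 2 * lam * du0 \<alpha> * \<eta> t + 1"

definition P0_bar ::
    "real \<Rightarrow> real \<Rightarrow> (real \<Rightarrow> real) \<Rightarrow> (real \<Rightarrow> real) \<Rightarrow> (real \<Rightarrow> real) \<Rightarrow> real \<Rightarrow> real" where
  "P0_bar lam kap du0 \<rho>0 \<eta> t =
     integral {0..1} (\<lambda>\<alpha>. Q_fun lam kap du0 \<rho>0 \<eta> \<alpha> t powr (- 1 / (2 * lam)))"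

end

theory Submission
  imports Defs
begin

text \<open>
  Write \<open>w(\<alpha>,t) = u\<^sub>x(\<gamma>(\<alpha>,t),t)\<close> and \<open>r(\<alpha>,t) = \<rho>(\<gamma>(\<alpha>,t),t)\<close>. Along a characteristic the system becomes
  \<open>w' = \<lambda>w\<^sup>2 + \<kappa>r\<^sup>2 + I(t)\<close>, \<open>r' = 2\<lambda>rw\<close>, and the jacobian is \<open>J = \<gamma>\<^sub>\<alpha> = exp(\<integral>w)\<close>. The function
  \<open>\<phi> = J powr (-\<lambda>)\<close> linearises the quadratic term, and \<open>r = \<rho>\<^sub>0/\<phi>\<^sup>2\<close>, so that \<open>\<phi>\<close> solves a Pinney (Ermakov)
  equation \<open>\<phi>'' = -\<lambda>I\<phi> - k/\<phi>\<^sup>3\<close> with \<open>k = \<lambda>\<kappa>\<rho>\<^sub>0(\<alpha>)\<^sup>2\<close>, in which the nonlocal term \<open>I\<close> is the same for all \<open>\<alpha>\<close>.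
  
  Let \<open>y\<close> solve the linear equation \<open>y'' = -\<lambda>Iy\<close> with \<open>y(0) = 1\<close>, \<open>y'(0) = 0\<close>. As long as \<open>y > 0\<close>, in the new time
  \<open>\<sigma>\<close> with \<open>\<sigma>' = 1/y\<^sup>2\<close> the square of \<open>\<phi>/y\<close> has constant second derivative, hence is a quadratic polynomial in
  \<open>\<sigma>\<close>; comparing initial values, \<open>\<phi>\<^sup>2 = y\<^sup>2 (C(\<alpha>)\<sigma>\<^sup>2 - 2\<lambda>u\<^sub>0'(\<alpha>)\<sigma> + 1)\<close> (\<open>pinney_solution_quadratic\<close>).
  Periodicity gives \<open>\<gamma>(1,t) - \<gamma>(0,t) = 1\<close>, that is \<open>\<integral>J d\<alpha> = 1\<close>, and this determines \<open>y\<close> from \<open>\<sigma>\<close>: \<open>y\<close> is the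
  \<open>\<lambda>\<close>-th power of the mean of \<open>Q powr (-1/(2\<lambda>))\<close> with \<open>\<eta>\<close> replaced by \<open>\<sigma>\<close>. Thus \<open>\<sigma>\<close> solves the same autonomous scalar
  equation as \<open>\<eta>\<close>, and \<open>\<sigma> = \<eta>\<close> by separation of variables (\<open>autonomous_ode_unique\<close>). The resulting
  formula for \<open>y\<close> in terms of \<open>\<eta>\<close> also excludes a first zero of \<open>y\<close> (\<open>pinney_family_closed_form\<close>). The formulas for
  \<open>J\<close> and \<open>r\<close> follow at once; the one for \<open>w\<close> contains \<open>y'/y\<close>, which is computed from \<open>\<integral>wJ d\<alpha> = 0\<close>.
  
  Two analytic points need care: characteristics pass through the junction points of the periodic
  extension, where \<open>u\<^sub>x\<^sub>x\<close> and \<open>\<rho>\<^sub>x\<close> may jump (\<open>periodic_ext_along_curve\<close>), and the differentiability of \<open>\<gamma>\<close> in \<open>\<alpha>\<close> has to be derived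
  from the differential equation (\<open>flow_has_derivative\<close>).
\<close>

section \<open>Periodic extensions along curves\<close>

lemma has_real_derivative_within_Un:
  fixes f :: "real \<Rightarrow> real"
  assumes "(f has_real_derivative D) (at x within S)" "(f has_real_derivative D) (at x within S')"
  shows "(f has_real_derivative D) (at x within S \<union> S')"
  using assms unfolding has_field_derivative_iff by (rule Lim_Un)

lemma has_real_derivative_at_of_open_subset:
  fixes f :: "real \<Rightarrow> real"
  assumes "(f has_real_derivative D) (at x within S)" "open V" "x \<in> V" "V \<subseteq> S"
  shows "(f has_real_derivative D) (at x)"
  using DERIV_subset[OF assms(1,4)] unfolding at_within_open[OF assms(3,2)] .

lemma obtain_floor_cell:
  fixes x :: real
  obtains n :: int where "x = of_int n" | n :: int where "of_int n < x" "x < of_int n + 1"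
proof (cases "x = of_int \<lfloor>x\<rfloor>")
  case False
  then have "of_int \<lfloor>x\<rfloor> < x" using of_int_floor_le[of x] by linarith
  then show ?thesis using that(2)[of "\<lfloor>x\<rfloor>"] by simp
qed (rule that(1))

text \<open>
  On a closed cell \<open>[n, n+1]\<close> the extension is a mere translate of the original function, the right
  endpoint included. Every analytic property of the extension is proved on closed cells and
  then glued at the integers.
\<close>

lemma periodic_ext_on_cell:
  assumes "f 0 t = f 1 t" "of_int n \<le> x" "x \<le> of_int n + 1"
  shows "periodic_ext f x t = f (x - of_int n) t"
proof (cases "x = of_int n + 1")
  case True
  then have "frac x = 0" by simp
  then show ?thesis using assms True by (simp add: periodic_ext_def)
next
  case False
  then have "\<lfloor>x\<rfloor> = n" using assms by (intro floor_unique) auto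
  then show ?thesis by (simp add: periodic_ext_def frac_def)
qed

lemma periodic_ext_add_1: "periodic_ext f (x + 1) t = periodic_ext f x t"
  by (simp add: periodic_ext_def frac_def)

lemma periodic_ext_unit_interval:
  assumes "f 0 t = f 1 t" "x \<in> {0..1}"
  shows "periodic_ext f x t = f x t"
  using periodic_ext_on_cell[of f t 0 x] assms by simp

lemma periodic_ext_continuous:
  assumes cont: "continuous_on ({0..1} \<times> {0..<T}) (\<lambda>(x, t). f x t)"
    and per: "\<And>t. t \<in> {0..<T} \<Longrightarrow> f 0 t = f 1 t"
  shows "continuous_on (UNIV \<times> {0..<T}) (\<lambda>(x, t). periodic_ext f x t)"
proof -
  have cell: "continuous_on ({of_int n..of_int n + 1} \<times> {0..<T}) (\<lambda>(x, t). periodic_ext f x t)"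
    for n :: int
  proof -
    have "continuous_on ({of_int n..of_int n + 1} \<times> {0..<T})
        ((\<lambda>(x, t). f x t) \<circ> (\<lambda>p. (fst p - of_int n, snd p)))"
      by (intro continuous_on_compose continuous_intros continuous_on_subset[OF cont]) auto
    then show ?thesis
      by (rule continuous_on_eq) (auto simp: periodic_ext_on_cell[of f _ n, OF per])
  qed
  have two: "continuous_on ({of_int n - 1..of_int n + 1} \<times> {0..<T}) (\<lambda>(x, t). periodic_ext f x t)"
    (is "continuous_on ?A ?f") for n :: int
  proof -
    have eq: "?A = {of_int n - 1..of_int n} \<times> {0..<T} \<union> {of_int n..of_int n + 1} \<times> {0..<T}"
      by auto
    have c1: "closedin (top_of_set ?A) ({of_int n - 1..of_int n} \<times> {0..<T})"
      by (auto simp: closedin_closed intro!: exI[of _ "{of_int n - 1..of_int n} \<times> UNIV"] closed_Times)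
    have c2: "closedin (top_of_set ?A) ({of_int n..of_int n + 1} \<times> {0..<T})"
      by (auto simp: closedin_closed intro!: exI[of _ "{of_int n..of_int n + 1} \<times> UNIV"] closed_Times)
    show ?thesis
      unfolding eq
      by (rule continuous_on_Un_local) (use c1 c2 cell[of "n - 1"] cell[of n] eq in auto)
  qed
  show ?thesis
    unfolding continuous_on_eq_continuous_within
  proof
    fix p :: "real \<times> real" assume p: "p \<in> UNIV \<times> {0..<T}"
    obtain x t where xt: "p = (x, t)" "t \<in> {0..<T}" using p by auto
    define n where "n = \<lfloor>x\<rfloor>"
    have n: "of_int n - 1 < x" "x < of_int n + 1" unfolding n_def by linarith+
    have "continuous (at p within {of_int n - 1..of_int n + 1} \<times> {0..<T}) (\<lambda>(x, t). periodic_ext f x t)"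
      using two[of n] n xt unfolding continuous_on_eq_continuous_within by auto
    moreover have "at p within {of_int n - 1..of_int n + 1} \<times> {0..<T} = at p within (UNIV \<times> {0..<T})"
      by (rule at_within_nhd[where S = "{of_int n - 1<..<of_int n + 1} \<times> UNIV"])
         (use n xt in \<open>auto intro!: open_Times\<close>)
    ultimately show "continuous (at p within UNIV \<times> {0..<T}) (\<lambda>(x, t). periodic_ext f x t)"
      by simp
  qed
qed

lemma periodic_ext_has_derivative:
  assumes der: "\<And>x. x \<in> {0..1} \<Longrightarrow> ((\<lambda>y. f y t) has_real_derivative f' x t) (at x within {0..1})"
    and per: "f 0 t = f 1 t" "f' 0 t = f' 1 t"
  shows "((\<lambda>y. periodic_ext f y t) has_real_derivative periodic_ext f' x t) (at x)"
proof -
  have cell: "((\<lambda>y. periodic_ext f y t) has_real_derivative periodic_ext f' x t)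
      (at x within {of_int n..of_int n + 1})"
    if "x \<in> {of_int n..of_int n + 1}" for n :: int
  proof -
    have "((\<lambda>y. f y t) has_real_derivative f' (x - of_int n) t)
        (at (x - of_int n) within (\<lambda>y. y - of_int n) ` {of_int n..of_int n + 1})"
      by (rule DERIV_subset[OF der]) (use that in auto)
    moreover have "((\<lambda>y. y - of_int n) has_real_derivative 1) (at x within {of_int n..of_int n + 1})"
      by (rule DERIV_cong[OF DERIV_diff[OF DERIV_ident DERIV_const]]) simp
    ultimately have "(((\<lambda>y. f y t) \<circ> (\<lambda>y. y - of_int n)) has_real_derivative f' (x - of_int n) t)
        (at x within {of_int n..of_int n + 1})"
      by (rule DERIV_cong[OF DERIV_image_chain]) simp
    then have "((\<lambda>y. periodic_ext f y t) has_real_derivative f' (x - of_int n) t)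
        (at x within {of_int n..of_int n + 1})"
      by (rule has_field_derivative_transform_within[where d = 1])
         (use that periodic_ext_on_cell[of f t n, OF per(1)] in auto)
    then show ?thesis using that periodic_ext_on_cell[of f' t n, OF per(2)] by auto
  qed
  show ?thesis
  proof (cases x rule: obtain_floor_cell)
    case (1 n)
    have "((\<lambda>y. periodic_ext f y t) has_real_derivative periodic_ext f' x t)
        (at x within {of_int (n - 1)..of_int (n - 1) + 1} \<union> {of_int n..of_int n + 1})"
      by (intro has_real_derivative_within_Un cell) (use 1 in auto)
    then show ?thesis
      by (rule has_real_derivative_at_of_open_subset[where V = "{of_int n - 1<..<of_int n + 1}"])
         (use 1 in auto)
  next
    case (2 n)
    show ?thesis
      by (rule has_real_derivative_at_of_open_subset[OF cell[of n], where V = "{of_int n<..<of_int n + 1}"])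
         (use 2 in auto)
  qed
qed

text \<open>
  The extension of \<open>f\<close> need not be differentiable in \<open>x\<close> at an integer, since the one-sided derivatives there may
  differ; but the convective combination \<open>f\<^sub>t + u f\<^sub>x\<close> equals the periodic function \<open>R\<close>. On the set of times
  which the curve spends in one closed cell the chain rule holds with derivative \<open>R\<close>, from either side, so
  the two one-sided derivatives agree when the curve meets an integer.
\<close>

lemma periodic_ext_along_curve:
  fixes c :: "real \<Rightarrow> real"
  assumes cont: "continuous_on ({0..1} \<times> {0<..<T}) (\<lambda>(x, t). fx x t)"
    and fx: "\<And>x t. x \<in> {0..1} \<Longrightarrow> t \<in> {0<..<T} \<Longrightarrow>
               ((\<lambda>y. f y t) has_real_derivative fx x t) (at x within {0..1})"
    and ft: "\<And>x t. x \<in> {0..1} \<Longrightarrow> t \<in> {0<..<T} \<Longrightarrow> (f x has_real_derivative ft x t) (at t)"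
    and transport: "\<And>x t. x \<in> {0..1} \<Longrightarrow> t \<in> {0<..<T} \<Longrightarrow> ft x t + u x t * fx x t = R x t"
    and per: "\<And>t. t \<in> {0<..<T} \<Longrightarrow> u 0 t = u 1 t"
             "\<And>t. t \<in> {0<..<T} \<Longrightarrow> f 0 t = f 1 t"
             "\<And>t. t \<in> {0<..<T} \<Longrightarrow> R 0 t = R 1 t"
    and c: "\<And>t. t \<in> {0<..<T} \<Longrightarrow> (c has_real_derivative periodic_ext u (c t) t) (at t)"
    and t: "t \<in> {0<..<T}"
  shows "((\<lambda>s. periodic_ext f (c s) s) has_real_derivative periodic_ext R (c t) t) (at t)"
proof -
  define A where "A n = {0<..<T} \<inter> c -` {of_int n..of_int n + 1}" for n :: int
  have joint: "((\<lambda>(s, x). f x s) has_derivative (\<lambda>(a, b). ft x s * a + fx x s * b))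
       (at (s, x) within {0<..<T} \<times> {0..1})" if "x \<in> {0..1}" "s \<in> {0<..<T}" for x s
  proof -
    have "((\<lambda>(s, x). f x s) has_derivative
        (\<lambda>(a, b). ft x s * a + blinfun_mult_right (fx x s) b)) (at (s, x) within {0<..<T} \<times> {0..1})"
    proof (rule has_derivative_partialsI[where f = "\<lambda>s x. f x s" and fx = "\<lambda>a. ft x s * a"
            and fy = "\<lambda>s x. blinfun_mult_right (fx x s)"])
      show "((\<lambda>s. f x s) has_derivative (*) (ft x s)) (at s within {0<..<T})"
        using ft[OF that] by (simp add: has_field_derivative_def has_derivative_at_withinI)
      show "((\<lambda>y. f y s) has_derivative blinfun_apply (blinfun_mult_right (fx x s)))
          (at x within {0..1})" if "s \<in> {0<..<T}" "x \<in> {0..1}" for s x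
        using fx[OF that(2,1)] by (simp add: has_field_derivative_def)
      have "continuous_on ({0<..<T} \<times> {0..1}) ((\<lambda>(x, t). fx x t) \<circ> (\<lambda>p. (snd p, fst p)))"
        by (intro continuous_on_compose continuous_intros continuous_on_subset[OF cont]) auto
      then have "continuous_on ({0<..<T} \<times> {0..1}) (\<lambda>(s, x). fx x s)"
        by (rule continuous_on_eq) auto
      then have "continuous_on ({0<..<T} \<times> {0..1}) (\<lambda>(s, x). blinfun_mult_right (fx x s))"
        unfolding case_prod_beta
        by (rule bounded_linear.continuous_on[OF bounded_linear_blinfun_mult_right])
      then show "continuous (at (s, x) within {0<..<T} \<times> {0..1}) (\<lambda>(s, x). blinfun_mult_right (fx x s))"
        using that by (auto simp: continuous_on_eq_continuous_within)
    qed (use that in auto)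
    then show ?thesis by simp
  qed
  have cell: "((\<lambda>s. periodic_ext f (c s) s) has_real_derivative periodic_ext R (c t) t)
      (at t within A n)" if "t \<in> A n" for n
  proof -
    have n: "of_int n \<le> c t" "c t \<le> of_int n + 1" using that by (auto simp: A_def)
    let ?x = "c t - of_int n"
    have x: "?x \<in> {0..1}" using n by auto
    have g: "((\<lambda>s. (s, c s - of_int n)) has_derivative (\<lambda>h. (h, periodic_ext u (c t) t * h)))
        (at t within A n)"
    proof (rule has_derivative_Pair)
      have "((\<lambda>s. c s - of_int n) has_real_derivative periodic_ext u (c t) t) (at t within A n)"
        using DERIV_diff[OF has_field_derivative_at_within[OF c[OF t]] DERIV_const] by simp
      then show "((\<lambda>s. c s - of_int n) has_derivative (\<lambda>h. periodic_ext u (c t) t * h))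
          (at t within A n)"
        by (simp add: has_field_derivative_def)
    qed simp
    have "((\<lambda>(s, x). f x s) has_derivative (\<lambda>(a, b). ft ?x t * a + fx ?x t * b))
        (at (t, ?x) within (\<lambda>s. (s, c s - of_int n)) ` A n)"
      by (rule has_derivative_subset[OF joint[OF x t]]) (auto simp: A_def)
    from has_derivative_in_compose[OF g this]
    have "((\<lambda>s. f (c s - of_int n) s) has_derivative
        (\<lambda>h. ft ?x t * h + fx ?x t * (periodic_ext u (c t) t * h))) (at t within A n)"
      by (simp only: case_prod_conv)
    moreover have "(\<lambda>h. ft ?x t * h + fx ?x t * (periodic_ext u (c t) t * h))
        = (*) (periodic_ext R (c t) t)"
      using periodic_ext_on_cell[of u t n, OF per(1)[OF t] n]
        periodic_ext_on_cell[of R t n, OF per(3)[OF t] n]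
      by (simp only: transport[OF x t, symmetric]) (simp add: algebra_simps fun_eq_iff)
    ultimately have "((\<lambda>s. f (c s - of_int n) s) has_real_derivative periodic_ext R (c t) t)
        (at t within A n)"
      by (simp add: has_field_derivative_def)
    then show ?thesis
    proof (rule has_field_derivative_transform_within[where d = 1])
      show "f (c s - of_int n) s = periodic_ext f (c s) s" if "s \<in> A n" for s
        using that periodic_ext_on_cell[of f s n "c s"] per(2)[of s] by (simp add: A_def)
    qed (use that in auto)
  qed
  have "continuous_on {0<..<T} c"
    by (rule DERIV_continuous_on, rule has_field_derivative_at_within, rule c)
  then have opn: "open ({0<..<T} \<inter> c -` V)" if "open V" for V
    using that by (intro continuous_open_preimage) auto
  show ?thesis
  proof (cases "c t" rule: obtain_floor_cell)
    case (1 n)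
    have "((\<lambda>s. periodic_ext f (c s) s) has_real_derivative periodic_ext R (c t) t)
        (at t within A (n - 1) \<union> A n)"
      by (intro has_real_derivative_within_Un cell) (use 1 t in \<open>auto simp: A_def\<close>)
    then show ?thesis
      by (rule has_real_derivative_at_of_open_subset
            [where V = "{0<..<T} \<inter> c -` {of_int n - 1<..<of_int n + 1}"])
         (use 1 t in \<open>auto intro: opn simp: A_def simp del: open_Int\<close>)
  next
    case (2 n)
    show ?thesis
      by (rule has_real_derivative_at_of_open_subset
            [OF cell[of n], where V = "{0<..<T} \<inter> c -` {of_int n<..<of_int n + 1}"])
         (use 2 t in \<open>auto intro!: opn simp: A_def\<close>)
  qed
qed

section \<open>Dependence of trajectories on the initial position\<close>

lemma mean_value_integral:
  fixes U V :: "real \<Rightarrow> real"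
  assumes "\<And>x. (U has_real_derivative V x) (at x)"
  shows "U y - U x = (y - x) * integral {0..1} (\<lambda>s. V (x + s * (y - x)))"
proof -
  have "((\<lambda>s. (y - x) * V (x + s * (y - x))) has_integral
      U (x + 1 * (y - x)) - U (x + 0 * (y - x))) {0..1}"
  proof (rule fundamental_theorem_of_calculus)
    show "((\<lambda>s. U (x + s * (y - x))) has_vector_derivative (y - x) * V (x + s * (y - x)))
        (at s within {0..1})" for s
      unfolding has_real_derivative_iff_has_vector_derivative[symmetric]
      by (rule has_field_derivative_at_within, rule DERIV_cong[OF DERIV_chain2[OF assms]])
         (auto intro!: derivative_eq_intros)
  qed simp
  from integral_unique[OF this] show ?thesis by simp
qed

lemma mean_value_integral_continuous:
  fixes V :: "real \<Rightarrow> real \<Rightarrow> real" and a b \<tau> :: "'a::topological_space \<Rightarrow> real"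
  assumes "continuous_on (UNIV \<times> J) (\<lambda>(x, t). V x t)"
    and "continuous_on X a" "continuous_on X b" "continuous_on X \<tau>" "\<tau> ` X \<subseteq> J"
  shows "continuous_on X (\<lambda>p. integral {0..1} (\<lambda>s. V (a p + s * (b p - a p)) (\<tau> p)))"
proof -
  have fst: "continuous_on (X \<times> {0..1}) (\<lambda>q. h (fst q))" if "continuous_on X h"
    for h :: "'a \<Rightarrow> real"
    by (rule continuous_on_compose2[OF that]) (auto intro!: continuous_intros)
  have "continuous_on (X \<times> {0..1}) ((\<lambda>(x, t). V x t) \<circ>
      (\<lambda>q. (a (fst q) + snd q * (b (fst q) - a (fst q)), \<tau> (fst q))))"
    by (intro continuous_on_compose continuous_intros fst assms(2-4)
          continuous_on_subset[OF assms(1)]) (use assms(5) in auto)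
  then have "continuous_on (X \<times> cbox 0 1) (\<lambda>(p, s). V (a p + s * (b p - a p)) (\<tau> p))"
    by (simp add: case_prod_beta o_def)
  from integral_continuous_on_param[OF this] show ?thesis by simp
qed

lemma has_real_derivative_0_imp_const:
  fixes f :: "real \<Rightarrow> real"
  assumes "continuous_on {0..<T} f"
    and "\<And>t. t \<in> {0<..<T} \<Longrightarrow> (f has_real_derivative 0) (at t)"
    and "t \<in> {0..<T}"
  shows "f t = f 0"
proof (cases "t = 0")
  case False
  show ?thesis
    by (rule DERIV_isconst_end[OF _ continuous_on_subset[OF assms(1)]])
       (use False assms(2,3) in auto)
qed simp

lemma at_within_half_open_eq_at: "t \<in> {0<..<T} \<Longrightarrow> at t within {0..<T} = at (t::real)"
  by (rule at_within_interior) (auto simp: interior_atLeastLessThan)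

lemma has_real_derivative_integral_half_open:
  fixes m :: "real \<Rightarrow> real"
  assumes "continuous_on {0..<T} m" "t \<in> {0..<T}"
  shows "((\<lambda>t. integral {0..t} m) has_real_derivative m t) (at t within {0..<T})"
proof -
  define b where "b = (t + T) / 2"
  have b: "t < b" "b < T" using assms(2) by (auto simp: b_def)
  have "((\<lambda>t. integral {0..t} m) has_real_derivative m t) (at t within {0..b})"
    by (rule integral_has_real_derivative[OF continuous_on_subset[OF assms(1)]])
       (use b assms(2) in auto)
  moreover have "at t within {0..b} = at t within {0..<T}"
    by (rule at_within_nhd[where S = "{..<b}"]) (use b in auto)
  ultimately show ?thesis by simp
qed

lemma linear_ode_solution:
  fixes z m :: "real \<Rightarrow> real"
  assumes m: "continuous_on {0..<T} m"
    and z: "\<And>t. t \<in> {0..<T} \<Longrightarrow> (z has_real_derivative m t * z t) (at t within {0..<T})"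
    and t: "t \<in> {0..<T}"
  shows "z t = z 0 * exp (integral {0..t} m)"
proof -
  let ?g = "\<lambda>t. z t * exp (- integral {0..t} m)"
  have g: "(?g has_real_derivative 0) (at t within {0..<T})" if "t \<in> {0..<T}" for t
    by (rule derivative_eq_intros z has_real_derivative_integral_half_open[OF m] that refl)+ simp
  have "?g t = ?g 0"
  proof (rule has_real_derivative_0_imp_const[OF _ _ t])
    show "continuous_on {0..<T} ?g" by (rule DERIV_continuous_on[OF g])
    show "(?g has_real_derivative 0) (at t)" if "t \<in> {0<..<T}" for t
      using g[of t] that by (simp add: at_within_half_open_eq_at)
  qed
  then show ?thesis by (simp add: exp_minus field_simps)
qed

text \<open>
  Writing the difference of velocities as a mean value integral turns the difference of two
  trajectories into a solution of a scalar linear equation.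
\<close>

lemma trajectories_difference:
  fixes U V :: "real \<Rightarrow> real \<Rightarrow> real"
  assumes V: "continuous_on (UNIV \<times> {0..<T}) (\<lambda>(x, t). V x t)"
    and U: "\<And>x t. t \<in> {0..<T} \<Longrightarrow> ((\<lambda>y. U y t) has_real_derivative V x t) (at x)"
    and a: "\<And>t. t \<in> {0..<T} \<Longrightarrow> (a has_real_derivative U (a t) t) (at t within {0..<T})"
    and b: "\<And>t. t \<in> {0..<T} \<Longrightarrow> (b has_real_derivative U (b t) t) (at t within {0..<T})"
    and t: "t \<in> {0..<T}"
  shows "b t - a t = (b 0 - a 0) *
    exp (integral {0..t} (\<lambda>r. integral {0..1} (\<lambda>s. V (a r + s * (b r - a r)) r)))"
proof (rule linear_ode_solution[OF _ _ t])
  show "continuous_on {0..<T} (\<lambda>r. integral {0..1} (\<lambda>s. V (a r + s * (b r - a r)) r))"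
    by (rule mean_value_integral_continuous[OF V])
       (auto intro!: DERIV_continuous_on a b)
  show "((\<lambda>t. b t - a t) has_real_derivative
      integral {0..1} (\<lambda>s. V (a t + s * (b t - a t)) t) * (b t - a t)) (at t within {0..<T})"
    if "t \<in> {0..<T}" for t
    using DERIV_diff[OF b[OF that] a[OF that]] mean_value_integral[OF U[OF that]]
    by (simp add: mult.commute)
qed

text \<open>
  In one space dimension the difference quotient of the flow is explicitly the exponential of a
  parameter integral over the segment between the two trajectories, so its limit only requires joint continuity
  of \<open>\<gamma>\<close>. The latter follows from a Lipschitz bound in \<open>a\<close>, uniform in time, given by the bound on \<open>V\<close>.
\<close>

lemma flow_has_derivative:
  fixes U V \<gamma> :: "real \<Rightarrow> real \<Rightarrow> real"
  assumes V: "continuous_on (UNIV \<times> {0..<T}) (\<lambda>(x, t). V x t)"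
    and U: "\<And>x t. t \<in> {0..<T} \<Longrightarrow> ((\<lambda>y. U y t) has_real_derivative V x t) (at x)"
    and bound: "\<And>x s. s \<in> {0..t} \<Longrightarrow> V x s \<le> M"
    and start: "\<And>a. a \<in> A \<Longrightarrow> \<gamma> a 0 = a"
    and \<gamma>: "\<And>a t. a \<in> A \<Longrightarrow> t \<in> {0..<T} \<Longrightarrow>
              (\<gamma> a has_real_derivative U (\<gamma> a t) t) (at t within {0..<T})"
    and t: "t \<in> {0..<T}" and \<alpha>: "\<alpha> \<in> A"
  shows "((\<lambda>a. \<gamma> a t) has_real_derivative exp (integral {0..t} (\<lambda>s. V (\<gamma> \<alpha> s) s)))
           (at \<alpha> within A)"
proof -
  define m where "m a b r = integral {0..1} (\<lambda>s. V (\<gamma> a r + s * (\<gamma> b r - \<gamma> a r)) r)" for a b r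
  have diff: "\<gamma> b r - \<gamma> a r = (b - a) * exp (integral {0..r} (m a b))"
    if "a \<in> A" "b \<in> A" "r \<in> {0..<T}" for a b r
    using trajectories_difference[OF V U \<gamma> \<gamma>, of a b r] that by (simp add: m_def[abs_def] start)
  have m_diag: "m \<alpha> \<alpha> = (\<lambda>s. V (\<gamma> \<alpha> s) s)" by (simp add: m_def fun_eq_iff)
  have time: "continuous_on {0..<T} (\<gamma> a)" if "a \<in> A" for a
    by (rule DERIV_continuous_on[OF \<gamma>[OF that]])
  have mcont: "continuous_on {0..<T} (m a b)" if "a \<in> A" "b \<in> A" for a b
    unfolding m_def by (rule mean_value_integral_continuous[OF V]) (auto intro: time that)
  have lip: "\<bar>\<gamma> b r - \<gamma> a r\<bar> \<le> exp (\<bar>M\<bar> * t) * \<bar>b - a\<bar>"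
    if "a \<in> A" "b \<in> A" "r \<in> {0..t}" for a b r
  proof -
    have r: "r \<in> {0..<T}" using that t by auto
    have "m a b q \<le> \<bar>M\<bar>" if q: "q \<in> {0..r}" for q
    proof -
      have "integral {0..1} (\<lambda>s. V (\<gamma> a q + s * (\<gamma> b q - \<gamma> a q)) q) \<le> integral {0..1} (\<lambda>s::real. \<bar>M\<bar>)"
      proof (rule integral_le)
        have qT: "q \<in> {0..<T}" using q r by auto
        have "continuous_on {0..1} ((\<lambda>(x, t). V x t) \<circ> (\<lambda>s. (\<gamma> a q + s * (\<gamma> b q - \<gamma> a q), q)))"
          by (intro continuous_on_compose continuous_intros continuous_on_subset[OF V]) (use qT in auto)
        then show "(\<lambda>s. V (\<gamma> a q + s * (\<gamma> b q - \<gamma> a q)) q) integrable_on {0..1}"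
          by (intro integrable_continuous_real) (simp add: o_def)
        show "V (\<gamma> a q + s * (\<gamma> b q - \<gamma> a q)) q \<le> \<bar>M\<bar>" for s
          using bound[of q "\<gamma> a q + s * (\<gamma> b q - \<gamma> a q)"] q \<open>r \<in> {0..t}\<close> by auto
      qed auto
      then show ?thesis by (simp add: m_def)
    qed
    then have "integral {0..r} (m a b) \<le> integral {0..r} (\<lambda>_. \<bar>M\<bar>)"
      using r by (intro integral_le integrable_continuous_real continuous_on_subset[OF mcont])
                 (auto simp: that)
    also have "\<dots> = \<bar>M\<bar> * r" using r by (simp add: mult.commute)
    also have "\<dots> \<le> \<bar>M\<bar> * t" using that by (intro mult_left_mono) auto
    finally show ?thesis
      using diff[OF that(1,2) r] by (simp add: abs_mult mult.commute mult_left_mono)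
  qed
  have joint: "continuous_on (A \<times> {0..t}) (\<lambda>(a, r). \<gamma> a r)"
    unfolding continuous_on_def
  proof
    fix p assume "p \<in> A \<times> {0..t}"
    then obtain a r where p: "p = (a, r)" and a: "a \<in> A" and r: "r \<in> {0..t}" by auto
    have "((\<lambda>p. \<bar>\<gamma> (fst p) (snd p) - \<gamma> a (snd p)\<bar> + \<bar>\<gamma> a (snd p) - \<gamma> a r\<bar>) \<longlongrightarrow> 0)
        (at (a, r) within A \<times> {0..t})"
    proof (rule tendsto_eq_intros)
      have "((\<lambda>p. exp (\<bar>M\<bar> * t) * \<bar>fst p - a\<bar>) \<longlongrightarrow> exp (\<bar>M\<bar> * t) * \<bar>fst (a, r) - a\<bar>)
          (at (a, r) within A \<times> {0..t})"
        by (intro tendsto_intros)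
      then have "((\<lambda>p. exp (\<bar>M\<bar> * t) * \<bar>fst p - a\<bar>) \<longlongrightarrow> 0) (at (a, r) within A \<times> {0..t})"
        by simp
      then show "((\<lambda>p. \<bar>\<gamma> (fst p) (snd p) - \<gamma> a (snd p)\<bar>) \<longlongrightarrow> 0) (at (a, r) within A \<times> {0..t})"
        by (rule Lim_null_comparison[rotated])
           (use lip a in \<open>auto simp: eventually_at_filter intro!: always_eventually\<close>)
      have "continuous_on (A \<times> {0..t}) (\<lambda>p. \<bar>\<gamma> a (snd p) - \<gamma> a r\<bar>)"
        by (intro continuous_intros continuous_on_compose2[OF time[OF a]]) (use t in auto)
      then show "((\<lambda>p. \<bar>\<gamma> a (snd p) - \<gamma> a r\<bar>) \<longlongrightarrow> 0) (at (a, r) within A \<times> {0..t})"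
        using a r by (force simp: continuous_on_def)
    qed simp
    then have "((\<lambda>p. \<gamma> (fst p) (snd p) - \<gamma> a r) \<longlongrightarrow> 0) (at (a, r) within A \<times> {0..t})"
      by (rule Lim_null_comparison[rotated]) (auto intro!: always_eventually)
    then show "((\<lambda>(a, r). \<gamma> a r) \<longlongrightarrow> (case p of (a, r) \<Rightarrow> \<gamma> a r)) (at p within A \<times> {0..t})"
      unfolding p by (subst LIM_zero_iff[symmetric]) (simp add: case_prod_beta)
  qed
  have "continuous_on (A \<times> {0..t}) (\<lambda>p. \<gamma> \<alpha> (snd p))"
    by (intro continuous_on_compose2[OF time[OF \<alpha>]] continuous_intros) (use t in auto)
  then have "continuous_on (A \<times> {0..t}) (\<lambda>p. m \<alpha> (fst p) (snd p))"
    unfolding m_def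
    by (intro mean_value_integral_continuous[OF V] joint[unfolded case_prod_beta] continuous_intros)
       (use t in auto)
  then have "continuous_on (A \<times> cbox 0 t) (\<lambda>(a, r). m \<alpha> a r)" by (simp add: case_prod_beta)
  from integral_continuous_on_param[OF this]
  have "continuous_on A (\<lambda>a. exp (integral {0..t} (m \<alpha> a)))"
    by (auto intro!: continuous_intros)
  then have "((\<lambda>a. exp (integral {0..t} (m \<alpha> a))) \<longlongrightarrow> exp (integral {0..t} (m \<alpha> \<alpha>))) (at \<alpha> within A)"
    using \<alpha> by (auto simp: continuous_on_def)
  then have "((\<lambda>a. exp (integral {0..t} (m \<alpha> a))) \<longlongrightarrow> exp (integral {0..t} (\<lambda>s. V (\<gamma> \<alpha> s) s)))
      (at \<alpha> within A)"
    unfolding m_diag .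
  then show ?thesis
    unfolding has_field_derivative_iff
    by (rule Lim_transform_eventually) (auto simp: eventually_at_filter diff[OF \<alpha> _ t] intro!: always_eventually)
qed

section \<open>The Pinney equation\<close>

lemma constant_coefficient_ode:
  fixes k a :: real
  obtains g g' :: "real \<Rightarrow> real"
  where "\<And>x. (g has_real_derivative g' x) (at x)" "\<And>x. (g' has_real_derivative k * g x) (at x)"
    "g 0 = 1" "g' 0 = a"
proof -
  define c where "c = sqrt \<bar>k\<bar>"
  have c2: "c * c = \<bar>k\<bar>" by (simp add: c_def)
  consider "k = 0" | "k > 0" "c > 0" | "k < 0" "c > 0" by (auto simp: c_def) linarith
  then show thesis
  proof cases
    case 1
    show thesis
      by (rule that[of "\<lambda>x. 1 + a * x" "\<lambda>_. a"]) (auto intro!: derivative_eq_intros simp: 1)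
  next
    case 2
    then have k: "k = c * c" using c2 by simp
    show thesis
      by (rule that[of "\<lambda>x. cosh (c * x) + a / c * sinh (c * x)" "\<lambda>x. c * sinh (c * x) + a * cosh (c * x)"])
         (use 2 in \<open>auto intro!: derivative_eq_intros simp: k field_simps\<close>)
  next
    case 3
    then have k: "k = - (c * c)" using c2 by simp
    show thesis
      by (rule that[of "\<lambda>x. cos (c * x) + a / c * sin (c * x)" "\<lambda>x. - c * sin (c * x) + a * cos (c * x)"])
         (use 3 in \<open>auto intro!: derivative_eq_intros simp: k field_simps\<close>)
  qed
qed

text \<open>
  The pair \<open>(\<phi>, \<phi>')\<close> is a first-order form of \<open>\<phi>'' = -F\<phi> - k/\<phi>\<^sup>3\<close>, normalised by \<open>\<phi>(0) = 1\<close>. The equation is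
  imposed for \<open>t > 0\<close> only, because the solution has second derivatives only there.
\<close>

definition pinney_solution ::
  "real \<Rightarrow> (real \<Rightarrow> real) \<Rightarrow> real \<Rightarrow> (real \<Rightarrow> real) \<Rightarrow> (real \<Rightarrow> real) \<Rightarrow> bool" where
  "pinney_solution T F k \<phi> \<phi>' \<longleftrightarrow>
     continuous_on {0..<T} \<phi> \<and> continuous_on {0..<T} \<phi>' \<and> \<phi> 0 = 1 \<and>
     (\<forall>t\<in>{0..<T}. \<phi> t > 0) \<and>
     (\<forall>t\<in>{0<..<T}. (\<phi> has_real_derivative \<phi>' t) (at t) \<and>
        (\<phi>' has_real_derivative - F t * \<phi> t - k / \<phi> t ^ 3) (at t))"

text \<open>
  One positive Pinney solution reduces \<open>y'' = -Fy\<close> to an equation with constant coefficients: with \<open>y = \<phi> g(\<tau>)\<close> and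
  \<open>\<tau>' = 1/\<phi>\<^sup>2\<close> the equation becomes \<open>g'' = k g\<close>. This produces a solution on all of \<open>[0,T)\<close>.
\<close>

lemma linear_solution_from_pinney:
  assumes "pinney_solution T F k \<phi> \<phi>'"
  obtains y y' where "continuous_on {0..<T} y" "continuous_on {0..<T} y'" "y 0 = 1" "y' 0 = 0"
    "\<And>t. t \<in> {0<..<T} \<Longrightarrow> (y has_real_derivative y' t) (at t)"
    "\<And>t. t \<in> {0<..<T} \<Longrightarrow> (y' has_real_derivative - F t * y t) (at t)"
proof -
  note cont = assms[unfolded pinney_solution_def, THEN conjunct1]
    assms[unfolded pinney_solution_def, THEN conjunct2, THEN conjunct1]
  have pos: "t \<in> {0..<T} \<Longrightarrow> \<phi> t \<noteq> 0" and init: "\<phi> 0 = 1"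
    and d1: "t \<in> {0<..<T} \<Longrightarrow> (\<phi> has_real_derivative \<phi>' t) (at t)"
    and d2: "t \<in> {0<..<T} \<Longrightarrow> (\<phi>' has_real_derivative - F t * \<phi> t - k / \<phi> t ^ 3) (at t)" for t
    using assms by (force simp: pinney_solution_def)+
  obtain g g' where g: "\<And>x. (g has_real_derivative g' x) (at x)"
    "\<And>x. (g' has_real_derivative k * g x) (at x)" "g 0 = 1" "g' 0 = - \<phi>' 0"
    using constant_coefficient_ode[of k "- \<phi>' 0"] by blast
  define \<tau> where "\<tau> t = integral {0..t} (\<lambda>s. 1 / (\<phi> s)\<^sup>2)" for t
  have \<tau>': "(\<tau> has_real_derivative 1 / (\<phi> t)\<^sup>2) (at t within {0..<T})" if "t \<in> {0..<T}" for t
    unfolding \<tau>_def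
    by (rule has_real_derivative_integral_half_open[OF _ that]) (auto intro!: continuous_intros cont simp: pos)
  have \<tau>_cont: "continuous_on {0..<T} \<tau>" by (rule DERIV_continuous_on[OF \<tau>'])
  have \<tau>_at: "(\<tau> has_real_derivative 1 / (\<phi> t)\<^sup>2) (at t)" if "t \<in> {0<..<T}" for t
    using \<tau>'[of t] that by (simp add: at_within_half_open_eq_at)
  have gc: "continuous_on UNIV g" "continuous_on UNIV g'"
    by (rule DERIV_continuous_on, rule g)+
  have g\<tau>: "continuous_on {0..<T} (\<lambda>t. g (\<tau> t))" "continuous_on {0..<T} (\<lambda>t. g' (\<tau> t))"
    by (rule continuous_on_compose2[OF _ \<tau>_cont], rule gc, simp)+
  have "\<tau> 0 = 0" by (simp add: \<tau>_def)
  show thesis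
  proof (rule that[of "\<lambda>t. \<phi> t * g (\<tau> t)" "\<lambda>t. \<phi>' t * g (\<tau> t) + g' (\<tau> t) / \<phi> t"])
    show "((\<lambda>t. \<phi> t * g (\<tau> t)) has_real_derivative \<phi>' t * g (\<tau> t) + g' (\<tau> t) / \<phi> t) (at t)"
      if "t \<in> {0<..<T}" for t
      by (rule derivative_eq_intros d1 DERIV_chain2[OF g(1) \<tau>_at] that refl)+
         (use pos[of t] that in \<open>simp add: field_simps power2_eq_square\<close>)
    show "((\<lambda>t. \<phi>' t * g (\<tau> t) + g' (\<tau> t) / \<phi> t) has_real_derivative - F t * (\<phi> t * g (\<tau> t))) (at t)"
      if "t \<in> {0<..<T}" for t
      by (rule DERIV_cong[OF DERIV_add[OF DERIV_mult[OF d2 DERIV_chain2[OF g(1) \<tau>_at]]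
            DERIV_divide[OF DERIV_chain2[OF g(2) \<tau>_at] d1]]])
         (use pos[of t] that in \<open>simp_all add: field_simps power2_eq_square power3_eq_cube\<close>)
  qed (use g(3,4) init \<open>\<tau> 0 = 0\<close> in \<open>auto intro!: continuous_intros cont g\<tau> simp: pos\<close>)
qed

text \<open>
  In the time \<open>\<sigma>\<close> the quotient \<open>\<psi> = \<phi>/y\<close> satisfies \<open>\<psi>'' = -k/\<psi>\<^sup>3\<close>: the coefficient \<open>F\<close> disappears. Its first integral is
  \<open>E = \<psi>'\<^sup>2 - k/\<psi>\<^sup>2\<close>, and \<open>(\<psi>\<^sup>2)'' = 2E\<close>. In the original time, \<open>\<psi>'\<close> is the Wronskian \<open>W\<close> of \<open>\<phi>\<close> and \<open>y\<close>.
\<close>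

lemma pinney_solution_quadratic:
  assumes "pinney_solution T F k \<phi> \<phi>'" and "S \<le> T"
    and y_cont: "continuous_on {0..<S} y" "continuous_on {0..<S} y'" and init: "y 0 = 1" "y' 0 = 0"
    and y1: "\<And>t. t \<in> {0<..<S} \<Longrightarrow> (y has_real_derivative y' t) (at t)"
    and y2: "\<And>t. t \<in> {0<..<S} \<Longrightarrow> (y' has_real_derivative - F t * y t) (at t)"
    and y_pos: "\<And>t. t \<in> {0..<S} \<Longrightarrow> y t > 0"
    and \<sigma>_cont: "continuous_on {0..<S} \<sigma>" and \<sigma>_init: "\<sigma> 0 = 0"
    and \<sigma>: "\<And>t. t \<in> {0<..<S} \<Longrightarrow> (\<sigma> has_real_derivative 1 / (y t)\<^sup>2) (at t)"
    and t: "t \<in> {0..<S}"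
  shows "(\<phi> t)\<^sup>2 = (y t)\<^sup>2 * (((\<phi>' 0)\<^sup>2 - k) * (\<sigma> t)\<^sup>2 + 2 * \<phi>' 0 * \<sigma> t + 1)"
    and "\<phi>' t * y t - \<phi> t * y' t = y t / \<phi> t * (\<phi>' 0 + ((\<phi>' 0)\<^sup>2 - k) * \<sigma> t)"
proof -
  have sub: "t \<in> {0..<S} \<Longrightarrow> t \<in> {0..<T}" "t \<in> {0<..<S} \<Longrightarrow> t \<in> {0<..<T}" for t
    using assms(2) by auto
  have cont: "continuous_on {0..<S} \<phi>" "continuous_on {0..<S} \<phi>'"
    using assms(1) sub by (auto simp: pinney_solution_def intro: continuous_on_subset)
  have pos: "\<phi> t \<noteq> 0" if "t \<in> {0..<S}" for t
    using assms(1) sub(1)[OF that] unfolding pinney_solution_def by (metis less_irrefl)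
  have \<phi>0: "\<phi> 0 = 1" using assms(1) by (simp add: pinney_solution_def)
  have d1: "(\<phi> has_real_derivative \<phi>' t) (at t)"
    and d2: "(\<phi>' has_real_derivative - F t * \<phi> t - k / \<phi> t ^ 3) (at t)"
    if "t \<in> {0<..<S}" for t
    using assms(1) sub(2)[OF that] unfolding pinney_solution_def by blast+
  have y0: "t \<in> {0..<S} \<Longrightarrow> y t \<noteq> 0" for t using y_pos[of t] by auto
  define E where "E = (\<phi>' 0)\<^sup>2 - k"
  define W where "W t = \<phi>' t * y t - \<phi> t * y' t" for t
  have W_cont: "continuous_on {0..<S} W"
    unfolding W_def by (intro continuous_intros cont y_cont)
  have W': "(W has_real_derivative - k * y t / \<phi> t ^ 3) (at t)" if "t \<in> {0<..<S}" for t
    unfolding W_def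
    by (rule DERIV_cong[OF DERIV_diff[OF DERIV_mult[OF d2 y1] DERIV_mult[OF d1 y2]]])
       (use that in \<open>simp_all add: algebra_simps\<close>)
  have W0: "W 0 = \<phi>' 0" by (simp add: W_def init)
  have energy: "W t * W t - k * (y t / \<phi> t * (y t / \<phi> t)) = E" if "t \<in> {0..<S}" for t
  proof -
    have "W t * W t - k * (y t / \<phi> t * (y t / \<phi> t))
        = W 0 * W 0 - k * (y 0 / \<phi> 0 * (y 0 / \<phi> 0))"
    proof (rule has_real_derivative_0_imp_const[OF _ _ that])
      fix t assume t: "t \<in> {0<..<S}"
      then have t': "t \<in> {0..<S}" by auto
      have "((\<lambda>t. y t / \<phi> t) has_real_derivative (y' t * \<phi> t - y t * \<phi>' t) / (\<phi> t * \<phi> t)) (at t)"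
        by (intro DERIV_divide y1 d1 t pos t')
      moreover have "y' t * \<phi> t - y t * \<phi>' t = - W t" by (simp add: W_def)
      ultimately have r: "((\<lambda>t. y t / \<phi> t) has_real_derivative - W t / (\<phi> t * \<phi> t)) (at t)" by simp
      show "((\<lambda>t. W t * W t - k * (y t / \<phi> t * (y t / \<phi> t))) has_real_derivative 0) (at t)"
        by (rule DERIV_cong[OF DERIV_diff[OF DERIV_mult[OF W'[OF t] W'[OF t]]
              DERIV_cmult[OF DERIV_mult[OF r r]]]])
           (use pos[OF t'] in \<open>simp add: field_simps power3_eq_cube\<close>)
    qed (auto intro!: continuous_intros W_cont cont y_cont simp: pos)
    then show ?thesis by (simp add: W0 \<phi>0 init E_def power2_eq_square)
  qed
  have slope: "\<phi> t * W t / y t = \<phi>' 0 + E * \<sigma> t" if "t \<in> {0..<S}" for t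
  proof -
    have "\<phi> t * W t / y t - E * \<sigma> t = \<phi> 0 * W 0 / y 0 - E * \<sigma> 0"
    proof (rule has_real_derivative_0_imp_const[OF _ _ that])
      show "((\<lambda>t. \<phi> t * W t / y t - E * \<sigma> t) has_real_derivative 0) (at t)"
        if t: "t \<in> {0<..<S}" for t
      proof -
        have t': "t \<in> {0..<S}" using t by auto
        have "((\<lambda>t. \<phi> t * W t / y t - E * \<sigma> t) has_real_derivative
           (((\<phi>' t * W t + - k * y t / \<phi> t ^ 3 * \<phi> t) * y t - \<phi> t * W t * y' t) / (y t * y t)
             - E * (1 / (y t)\<^sup>2))) (at t)"
          by (intro DERIV_diff DERIV_divide DERIV_mult DERIV_cmult W' d1 y1 \<sigma> t y0 t')
        moreover have "((\<phi>' t * W t + - k * y t / \<phi> t ^ 3 * \<phi> t) * y t - \<phi> t * W t * y' t)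
            = W t * W t - k * (y t / \<phi> t * (y t / \<phi> t))"
          using pos[OF t'] by (simp add: W_def field_simps power2_eq_square power3_eq_cube)
        ultimately show ?thesis
          using energy[OF t'] by (simp add: power2_eq_square)
      qed
    qed (auto intro!: continuous_intros W_cont cont y_cont \<sigma>_cont simp: y0)
    then show ?thesis by (simp add: W0 \<phi>0 init \<sigma>_init)
  qed
  have "(\<phi> t)\<^sup>2 / (y t)\<^sup>2 - (E * (\<sigma> t)\<^sup>2 + 2 * \<phi>' 0 * \<sigma> t)
      = (\<phi> 0)\<^sup>2 / (y 0)\<^sup>2 - (E * (\<sigma> 0)\<^sup>2 + 2 * \<phi>' 0 * \<sigma> 0)"
  proof (rule has_real_derivative_0_imp_const[OF _ _ t])
    show "((\<lambda>t. (\<phi> t)\<^sup>2 / (y t)\<^sup>2 - (E * (\<sigma> t)\<^sup>2 + 2 * \<phi>' 0 * \<sigma> t)) has_real_derivative 0) (at t)"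
      if t: "t \<in> {0<..<S}" for t
    proof -
      have t': "t \<in> {0..<S}" using t by auto
      have "((\<lambda>t. \<phi> t / y t) has_real_derivative (\<phi>' t * y t - \<phi> t * y' t) / (y t * y t)) (at t)"
        by (intro DERIV_divide y1 d1 t y0 t')
      then have r: "((\<lambda>t. \<phi> t / y t) has_real_derivative W t / (y t * y t)) (at t)"
        by (simp add: W_def)
      have "((\<lambda>t. \<phi> t / y t * (\<phi> t / y t) - (E * (\<sigma> t * \<sigma> t) + 2 * \<phi>' 0 * \<sigma> t)) has_real_derivative
         2 * (\<phi> t * W t / y t) / (y t)\<^sup>2 - 2 * (\<phi>' 0 + E * \<sigma> t) / (y t)\<^sup>2) (at t)"
        by (rule DERIV_cong[OF DERIV_diff[OF DERIV_mult[OF r r] DERIV_add[OF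
              DERIV_cmult[OF DERIV_mult[OF \<sigma>[OF t] \<sigma>[OF t]]] DERIV_cmult[OF \<sigma>[OF t]]]]])
           (use y0[OF t'] in \<open>simp add: field_simps power2_eq_square\<close>)
      then have D: "((\<lambda>t. (\<phi> t)\<^sup>2 / (y t)\<^sup>2 - (E * (\<sigma> t)\<^sup>2 + 2 * \<phi>' 0 * \<sigma> t)) has_real_derivative
         2 * (\<phi> t * W t / y t) / (y t)\<^sup>2 - 2 * (\<phi>' 0 + E * \<sigma> t) / (y t)\<^sup>2) (at t)"
        by (simp add: power2_eq_square)
      show ?thesis using D by (simp add: slope[OF t'])
    qed
  qed (auto intro!: continuous_intros cont y_cont \<sigma>_cont simp: y0)
  then show "(\<phi> t)\<^sup>2 = (y t)\<^sup>2 * (((\<phi>' 0)\<^sup>2 - k) * (\<sigma> t)\<^sup>2 + 2 * \<phi>' 0 * \<sigma> t + 1)"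
    using y0[OF t] by (simp add: \<phi>0 init \<sigma>_init E_def field_simps)
  show "\<phi>' t * y t - \<phi> t * y' t = y t / \<phi> t * (\<phi>' 0 + ((\<phi>' 0)\<^sup>2 - k) * \<sigma> t)"
    using slope[OF t] y0[OF t] pos[OF t] by (simp add: W_def E_def field_simps)
qed

text \<open>
  Separation of variables: an antiderivative \<open>G\<close> of \<open>1/f\<close> satisfies \<open>G(x(t)) = G(x(0)) + t\<close> along every solution, and
  \<open>G\<close> is injective because \<open>f > 0\<close>.
\<close>

lemma autonomous_ode_unique:
  fixes f x z :: "real \<Rightarrow> real"
  assumes f: "continuous_on A f" "\<And>e. e \<in> A \<Longrightarrow> f e > 0"
    and x: "continuous_on {0..<S} x" "\<And>t. t \<in> {0..<S} \<Longrightarrow> x t \<in> A"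
      "\<And>t. t \<in> {0<..<S} \<Longrightarrow> (x has_real_derivative f (x t)) (at t)"
    and z: "continuous_on {0..<S} z" "\<And>t. t \<in> {0..<S} \<Longrightarrow> z t \<in> A"
      "\<And>t. t \<in> {0<..<S} \<Longrightarrow> (z has_real_derivative f (z t)) (at t)"
    and init: "x 0 = z 0" and t: "t \<in> {0..<S}"
  shows "x t = z t"
proof -
  define K where "K = x ` {0..t} \<union> z ` {0..t}"
  have sub: "{0..t} \<subseteq> {0..<S}" using t by auto
  have xc: "continuous_on {0..t} x" "continuous_on {0..t} z"
    using x(1) z(1) continuous_on_subset[OF _ sub] by auto
  \<comment> \<open>The two ranges share their starting point, so their union is a compact interval inside \<open>A\<close>.\<close>
  have "connected K"
    unfolding K_def
    by (rule connected_Un) (use t init xc in \<open>auto intro!: connected_continuous_image image_eqI[of _ _ 0]\<close>)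
  moreover have "compact K"
    unfolding K_def by (intro compact_Un compact_continuous_image xc) auto
  ultimately obtain a b where K: "K = {a..b}" by (metis connected_compact_interval_1)
  have KA: "K \<subseteq> A" using sub x(2) z(2) by (auto simp: K_def)
  have "continuous_on {a..b} (\<lambda>e. 1 / f e)"
    using f KA K by (intro continuous_intros continuous_on_subset[OF f(1)]) force+
  then obtain G where
    G: "\<And>e. e \<in> {a..b} \<Longrightarrow> (G has_vector_derivative 1 / f e) (at e within {a..b})"
    using antiderivative_continuous[of a b "\<lambda>e. 1 / f e"] by blast
  then have G: "(G has_real_derivative 1 / f e) (at e within K)" if "e \<in> K" for e
    using that by (simp add: K has_real_derivative_iff_has_vector_derivative)
  have G_cont: "continuous_on K G" by (rule DERIV_continuous_on[OF G])
  have clock: "G (w t) - t = G (w 0) - 0"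
    if w: "continuous_on {0..t} w" "w ` {0..t} \<subseteq> K"
      "\<And>s. s \<in> {0<..<t} \<Longrightarrow> (w has_real_derivative f (w s)) (at s)" for w
  proof (cases "t = 0")
    case False
    then have "0 < t" using t by auto
    then show ?thesis
    proof (rule DERIV_isconst_end[where f = "\<lambda>s. G (w s) - s"])
      show "continuous_on {0..t} (\<lambda>s. G (w s) - s)"
        by (intro continuous_intros continuous_on_compose2[OF G_cont w(1,2)])
      fix s assume s: "0 < s" "s < t"
      have ws: "w s \<in> K" using s w(2) by auto
      have "((G \<circ> w) has_real_derivative 1 / f (w s) * f (w s)) (at s within {0<..<t})"
        by (rule DERIV_image_chain[OF DERIV_subset[OF G[OF ws]] has_field_derivative_at_within[OF w(3)]])
           (use w(2) s in auto)
      moreover have "f (w s) \<noteq> 0" using f(2) KA ws by force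
      moreover have "at s within {0<..<t} = at s" using s by (intro at_within_open) auto
      ultimately have "((\<lambda>s. G (w s)) has_real_derivative 1) (at s)" by (simp add: o_def)
      from DERIV_diff[OF this DERIV_ident] show "((\<lambda>s. G (w s) - s) has_real_derivative 0) (at s)" by simp
    qed
  qed simp
  have "G (x t) = G (z t)"
    using clock[of x] clock[of z] xc x(3) z(3) init t by (auto simp: K_def)
  moreover have "G p < G q" if "p < q" "p \<in> K" "q \<in> K" for p q
  proof (rule DERIV_pos_imp_increasing_open[OF that(1)])
    fix e assume e: "p < e" "e < q"
    then have "e \<in> K" using that K by auto
    have "(G has_real_derivative 1 / f e) (at e)"
      by (rule has_real_derivative_at_of_open_subset[OF G[OF \<open>e \<in> K\<close>], of "{p<..<q}"])
         (use e that K in auto)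
    moreover have "f e > 0" using f(2) KA \<open>e \<in> K\<close> by auto
    ultimately show "\<exists>d. (G has_real_derivative d) (at e) \<and> 0 < d" by auto
  next
    show "continuous_on {p..q} G" by (rule continuous_on_subset[OF G_cont]) (use that K in auto)
  qed
  moreover have "x t \<in> K" "z t \<in> K" using t by (auto simp: K_def)
  ultimately show ?thesis by (metis less_irrefl linorder_neqE_linordered_idom)
qed

section \<open>Identification of the time change\<close>

lemma integral_continuous_pos:
  fixes f :: "real \<Rightarrow> real"
  assumes "continuous_on {0..1} f" "\<And>x. x \<in> {0..1} \<Longrightarrow> f x > 0"
  shows "integral {0..1} f > 0"
proof -
  obtain x0 where x0: "x0 \<in> {0..1}" "\<And>x. x \<in> {0..1} \<Longrightarrow> f x0 \<le> f x"
    using continuous_attains_inf[OF _ _ assms(1)] by auto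
  have "integral {0..1} (\<lambda>_::real. f x0) \<le> integral {0..1} f"
    by (intro integral_le integrable_continuous_real assms x0 continuous_intros)
  then show ?thesis using assms(2)[OF x0(1)] by simp
qed

lemma square_powr:
  fixes x a :: real
  assumes "x > 0"
  shows "(x\<^sup>2) powr a = x powr (2 * a)"
  unfolding power2_eq_square mult_2 powr_add using assms by (simp add: powr_mult)

lemma powr_square: "(x powr a)\<^sup>2 = (x::real) powr (2 * a)"
  by (simp only: power2_eq_square mult_2 powr_add)

text \<open>
  The Pinney solutions share the linear solution \<open>y\<close>, and the normalisation \<open>mass\<close> expresses \<open>y\<close> through \<open>\<sigma>\<close>,
  which makes the equation \<open>\<sigma>' = 1/y\<^sup>2\<close> autonomous; it is the equation of \<open>\<eta>\<close>. The unknown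
  \<open>Y\<close> in the conclusion is the logarithmic derivative \<open>y'/y\<close>.
\<close>

lemma pinney_family_closed_form:
  fixes lam kap T :: real
  assumes lam: "lam \<noteq> 0"
    and du0: "continuous_on {0..1} du0" and \<rho>0: "continuous_on {0..1} \<rho>0"
    and pinney: "\<And>\<alpha>. \<alpha> \<in> {0..1} \<Longrightarrow> pinney_solution T F (lam * kap * (\<rho>0 \<alpha>)\<^sup>2) (\<phi> \<alpha>) (\<phi>' \<alpha>)"
    and slope0: "\<And>\<alpha>. \<alpha> \<in> {0..1} \<Longrightarrow> \<phi>' \<alpha> 0 = - lam * du0 \<alpha>"
    and mass: "\<And>t. t \<in> {0..<T} \<Longrightarrow> integral {0..1} (\<lambda>\<alpha>. \<phi> \<alpha> t powr (- 1 / lam)) = 1"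
    and \<eta>0: "\<eta> 0 = 0"
    and \<eta>: "\<And>t. t \<in> {0..<T} \<Longrightarrow> (\<eta> has_real_derivative
              P0_bar lam kap du0 \<rho>0 \<eta> t powr (- 2 * lam)) (at t within {0..<T})"
    and Q_pos: "\<And>\<alpha> t. \<alpha> \<in> {0..1} \<Longrightarrow> t \<in> {0..<T} \<Longrightarrow> Q_fun lam kap du0 \<rho>0 \<eta> \<alpha> t > 0"
  obtains Y where
    "\<And>t. t \<in> {0..<T} \<Longrightarrow> P0_bar lam kap du0 \<rho>0 \<eta> t > 0"
    "\<And>\<alpha> t. \<alpha> \<in> {0..1} \<Longrightarrow> t \<in> {0..<T} \<Longrightarrow>
       (\<phi> \<alpha> t)\<^sup>2 = P0_bar lam kap du0 \<rho>0 \<eta> t powr (2 * lam) * Q_fun lam kap du0 \<rho>0 \<eta> \<alpha> t"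
    "\<And>\<alpha> t. \<alpha> \<in> {0..1} \<Longrightarrow> t \<in> {0..<T} \<Longrightarrow>
       \<phi>' \<alpha> t / \<phi> \<alpha> t = Y t - (lam * du0 \<alpha> - \<eta> t * C_coeff lam kap du0 \<rho>0 \<alpha>) / (\<phi> \<alpha> t)\<^sup>2"
proof -
  define q where "q e \<alpha> = C_coeff lam kap du0 \<rho>0 \<alpha> * e\<^sup>2 - 2 * lam * du0 \<alpha> * e + 1" for e \<alpha>
  define P where "P e = integral {0..1} (\<lambda>\<alpha>. q e \<alpha> powr (- 1 / (2 * lam)))" for e
  define A where "A = {e. \<forall>\<alpha>\<in>{0..1}. q e \<alpha> > 0}"
  have Q_eq: "Q_fun lam kap du0 \<rho>0 \<eta> \<alpha> t = q (\<eta> t) \<alpha>" for \<alpha> t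
    by (simp add: Q_fun_def q_def)
  have P_eq: "P0_bar lam kap du0 \<rho>0 \<eta> t = P (\<eta> t)" for t
    by (simp add: P0_bar_def Q_eq P_def)
  have \<eta>_A: "\<eta> t \<in> A" if "t \<in> {0..<T}" for t
    using Q_pos[OF _ that] by (simp add: A_def Q_eq)
  have \<eta>_cont: "continuous_on {0..<T} \<eta>" by (rule DERIV_continuous_on[OF \<eta>])
  have C_cont: "continuous_on {0..1} (C_coeff lam kap du0 \<rho>0)"
    unfolding C_coeff_def by (intro continuous_intros du0 \<rho>0)
  have snd: "continuous_on (A \<times> {0..1}) (\<lambda>p. h (snd p))" if "continuous_on {0..1} h"
    for h :: "real \<Rightarrow> real"
    by (rule continuous_on_compose2[OF that]) (auto intro!: continuous_intros)
  have "continuous_on (A \<times> {0..1}) (\<lambda>p. q (fst p) (snd p) powr (- 1 / (2 * lam)))"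
    unfolding q_def
    by (intro continuous_intros snd C_cont du0) (auto simp: A_def q_def less_imp_neq[THEN not_sym])
  then have "continuous_on (A \<times> cbox 0 1) (\<lambda>(e, \<alpha>). q e \<alpha> powr (- 1 / (2 * lam)))"
    by (simp add: case_prod_beta)
  from integral_continuous_on_param[OF this] have P_cont: "continuous_on A P"
    by (simp add: P_def[abs_def])
  have P_pos: "P e > 0" if "e \<in> A" for e
    unfolding P_def
  proof (rule integral_continuous_pos)
    show "continuous_on {0..1} (\<lambda>\<alpha>. q e \<alpha> powr (- 1 / (2 * lam)))"
      unfolding q_def
      by (intro continuous_intros C_cont du0)
         (use that in \<open>auto simp: A_def q_def less_imp_neq[THEN not_sym]\<close>)
    show "q e \<alpha> powr (- 1 / (2 * lam)) > 0" if "\<alpha> \<in> {0..1}" for \<alpha>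
      using \<open>e \<in> A\<close> that unfolding A_def by (metis (mono_tags) mem_Collect_eq powr_gt_zero less_irrefl)
  qed
  have "0 \<in> {0..1::real}" by simp
  from linear_solution_from_pinney[OF pinney[OF this]]
  obtain y y' where y: "continuous_on {0..<T} y" "continuous_on {0..<T} y'" "y 0 = 1" "y' 0 = 0"
    "\<And>t. t \<in> {0<..<T} \<Longrightarrow> (y has_real_derivative y' t) (at t)"
    "\<And>t. t \<in> {0<..<T} \<Longrightarrow> (y' has_real_derivative - F t * y t) (at t)"
    by blast
  \<comment> \<open>Positivity of \<open>y\<close> is so far known only near \<open>0\<close>, hence the restriction to an initial interval.\<close>
  have step: "y t = P (\<eta> t) powr lam"
    "\<And>\<alpha>. \<alpha> \<in> {0..1} \<Longrightarrow> (\<phi> \<alpha> t)\<^sup>2 = (y t)\<^sup>2 * q (\<eta> t) \<alpha>"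
    "\<And>\<alpha>. \<alpha> \<in> {0..1} \<Longrightarrow> \<phi>' \<alpha> t * y t - \<phi> \<alpha> t * y' t
       = y t / \<phi> \<alpha> t * (C_coeff lam kap du0 \<rho>0 \<alpha> * \<eta> t - lam * du0 \<alpha>)"
    if "S \<le> T" and y_pos: "\<And>s. s \<in> {0..<S} \<Longrightarrow> y s > 0" and "t \<in> {0..<S}" for S t
  proof -
    define \<sigma> where "\<sigma> t = integral {0..t} (\<lambda>s. 1 / (y s)\<^sup>2)" for t
    have y_cont: "continuous_on {0..<S} y" "continuous_on {0..<S} y'"
      using y(1,2) \<open>S \<le> T\<close> by (auto intro: continuous_on_subset)
    have \<sigma>': "(\<sigma> has_real_derivative 1 / (y t)\<^sup>2) (at t within {0..<S})" if "t \<in> {0..<S}" for t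
      unfolding \<sigma>_def
      by (rule has_real_derivative_integral_half_open[OF _ that])
         (auto intro!: continuous_intros y_cont dest: y_pos)
    have \<sigma>_at: "(\<sigma> has_real_derivative 1 / (y t)\<^sup>2) (at t)" if "t \<in> {0<..<S}" for t
      using \<sigma>'[of t] that by (simp add: at_within_half_open_eq_at)
    have \<sigma>_cont: "continuous_on {0..<S} \<sigma>" by (rule DERIV_continuous_on[OF \<sigma>'])
    have \<sigma>0: "\<sigma> 0 = 0" by (simp add: \<sigma>_def)
    have quad: "(\<phi> \<alpha> s)\<^sup>2 = (y s)\<^sup>2 * q (\<sigma> s) \<alpha>"
      and wron: "\<phi>' \<alpha> s * y s - \<phi> \<alpha> s * y' s
        = y s / \<phi> \<alpha> s * (C_coeff lam kap du0 \<rho>0 \<alpha> * \<sigma> s - lam * du0 \<alpha>)"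
      if "\<alpha> \<in> {0..1}" "s \<in> {0..<S}" for \<alpha> s
    proof -
      have "(\<phi>' \<alpha> 0)\<^sup>2 - lam * kap * (\<rho>0 \<alpha>)\<^sup>2 = C_coeff lam kap du0 \<rho>0 \<alpha>"
        by (simp add: slope0[OF that(1)] C_coeff_def power2_eq_square algebra_simps)
      moreover note pinney_solution_quadratic[OF pinney[OF that(1)] \<open>S \<le> T\<close> y_cont y(3,4) y(5,6)
          y_pos \<sigma>_cont \<sigma>0 \<sigma>_at that(2)]
      ultimately show "(\<phi> \<alpha> s)\<^sup>2 = (y s)\<^sup>2 * q (\<sigma> s) \<alpha>"
        and "\<phi>' \<alpha> s * y s - \<phi> \<alpha> s * y' s
          = y s / \<phi> \<alpha> s * (C_coeff lam kap du0 \<rho>0 \<alpha> * \<sigma> s - lam * du0 \<alpha>)"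
        using \<open>S \<le> T\<close> by (auto simp: slope0[OF that(1)] q_def)
    qed
    have \<phi>_pos: "\<phi> \<alpha> s > 0" if "\<alpha> \<in> {0..1}" "s \<in> {0..<S}" for \<alpha> s
      using pinney[OF that(1)] that(2) \<open>S \<le> T\<close> by (auto simp: pinney_solution_def)
    have \<sigma>_A: "\<sigma> s \<in> A" if "s \<in> {0..<S}" for s
      unfolding A_def
    proof safe
      fix \<alpha> :: real assume "\<alpha> \<in> {0..1}"
      then have "(y s)\<^sup>2 * q (\<sigma> s) \<alpha> > 0"
        using quad[OF _ that] \<phi>_pos[OF _ that] by (metis zero_less_power)
      then show "q (\<sigma> s) \<alpha> > 0" using y_pos[OF that] by (simp add: zero_less_mult_iff)
    qed
    have y_eq: "y s = P (\<sigma> s) powr lam" if s: "s \<in> {0..<S}" for s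
    proof -
      have "\<phi> \<alpha> s powr (- 1 / lam) = y s powr (- 1 / lam) * q (\<sigma> s) \<alpha> powr (- 1 / (2 * lam))"
        if \<alpha>: "\<alpha> \<in> {0..1}" for \<alpha>
      proof -
        have "\<phi> \<alpha> s powr (- 1 / lam) = ((\<phi> \<alpha> s)\<^sup>2) powr (- 1 / (2 * lam))"
          by (simp add: square_powr[OF \<phi>_pos[OF \<alpha> s]])
        also have "\<dots> = ((y s)\<^sup>2) powr (- 1 / (2 * lam)) * q (\<sigma> s) \<alpha> powr (- 1 / (2 * lam))"
          using \<sigma>_A[OF s] \<alpha> by (simp add: quad[OF \<alpha> s] powr_mult A_def less_imp_le)
        also have "((y s)\<^sup>2) powr (- 1 / (2 * lam)) = y s powr (- 1 / lam)"
          by (simp add: square_powr[OF y_pos[OF s]])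
        finally show ?thesis .
      qed
      then have "integral {0..1} (\<lambda>\<alpha>. \<phi> \<alpha> s powr (- 1 / lam))
          = integral {0..1} (\<lambda>\<alpha>. y s powr (- 1 / lam) * q (\<sigma> s) \<alpha> powr (- 1 / (2 * lam)))"
        by (rule integral_cong)
      then have "y s powr (- 1 / lam) * P (\<sigma> s) = 1"
        using mass[of s] s \<open>S \<le> T\<close> by (simp add: P_def)
      then have "P (\<sigma> s) = y s powr (1 / lam)"
        using y_pos[OF s] by (simp add: powr_minus field_simps)
      then show ?thesis using y_pos[OF s] lam by (simp add: powr_powr)
    qed
    have "\<sigma> t = \<eta> t"
    proof (rule autonomous_ode_unique[where f = "\<lambda>e. P e powr (- 2 * lam)"
          and A = A and S = S and x = \<sigma> and z = \<eta>])
      show "continuous_on A (\<lambda>e. P e powr (- 2 * lam))"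
        using P_pos by (intro continuous_intros P_cont) force
      show "(\<sigma> has_real_derivative P (\<sigma> s) powr (- 2 * lam)) (at s)" if "s \<in> {0<..<S}" for s
      proof -
        have "P (\<sigma> s) > 0" "y s = P (\<sigma> s) powr lam" using P_pos \<sigma>_A y_eq that by auto
        then have "1 / (y s)\<^sup>2 = P (\<sigma> s) powr (- 2 * lam)"
          by (simp add: powr_square powr_minus_divide)
        then show ?thesis using \<sigma>_at[OF that] by simp
      qed
      show "(\<eta> has_real_derivative P (\<eta> s) powr (- 2 * lam)) (at s)" if "s \<in> {0<..<S}" for s
      proof -
        have "s \<in> {0<..<T}" using that \<open>S \<le> T\<close> by auto
        then show ?thesis using \<eta>[of s] by (simp add: P_eq at_within_half_open_eq_at)
      qed
      show "\<eta> s \<in> A" if "s \<in> {0..<S}" for s using \<eta>_A[of s] that \<open>S \<le> T\<close> by auto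
      show "continuous_on {0..<S} \<eta>"
        using \<open>S \<le> T\<close> by (intro continuous_on_subset[OF \<eta>_cont]) auto
    qed (use P_pos \<sigma>_A \<sigma>_cont \<sigma>0 \<eta>0 \<open>t \<in> {0..<S}\<close> in \<open>auto intro: less_imp_le dest: P_pos\<close>)
    then show "y t = P (\<eta> t) powr lam"
      "\<And>\<alpha>. \<alpha> \<in> {0..1} \<Longrightarrow> (\<phi> \<alpha> t)\<^sup>2 = (y t)\<^sup>2 * q (\<eta> t) \<alpha>"
      "\<And>\<alpha>. \<alpha> \<in> {0..1} \<Longrightarrow> \<phi>' \<alpha> t * y t - \<phi> \<alpha> t * y' t
       = y t / \<phi> \<alpha> t * (C_coeff lam kap du0 \<rho>0 \<alpha> * \<eta> t - lam * du0 \<alpha>)"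
      using y_eq[of t] quad[of _ t] wron[of _ t] \<open>t \<in> {0..<S}\<close> by simp_all
  qed
  have y_pos: "y t > 0" if t: "t \<in> {0..<T}" for t
  proof (rule ccontr)
    assume neg: "\<not> y t > 0"
    define Z where "Z = {0..t} \<inter> y -` {..0}"
    have yt: "continuous_on {0..t} y" by (rule continuous_on_subset[OF y(1)]) (use t in auto)
    have "closed Z" unfolding Z_def by (rule continuous_closed_preimage[OF yt]) auto
    moreover have "t \<in> Z" using neg t by (auto simp: Z_def)
    moreover have bdd: "bdd_below Z" by (auto simp: Z_def intro: bdd_belowI[of _ 0])
    ultimately have z: "Inf Z \<in> Z" by (intro closed_contains_Inf) auto
    define S where "S = Inf Z"
    have S: "0 \<le> S" "S \<le> t" "y S \<le> 0" using z by (auto simp: Z_def S_def)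
    then have "0 < S" using y(3) by (cases "S = 0") auto
    have before: "y s > 0" if "s \<in> {0..<S}" for s
    proof (rule ccontr)
      assume "\<not> y s > 0"
      then have "s \<in> Z" using that S by (auto simp: Z_def)
      then show False using cInf_lower[OF _ bdd] that by (force simp: S_def)
    qed
    have cl: "closure {0..<S} = {0..S}" using \<open>0 < S\<close> by (simp add: closure_atLeastLessThan)
    have sub: "{0..S} \<subseteq> {0..<T}" using S t by auto
    \<comment> \<open>At a first zero \<open>S\<close>, the formula for \<open>y\<close> extends by continuity and gives a positive value.\<close>
    have "y S - P (\<eta> S) powr lam = 0"
    proof (rule continuous_constant_on_closure[of "{0..<S}" "\<lambda>s. y s - P (\<eta> s) powr lam"])
      show "continuous_on (closure {0..<S}) (\<lambda>s. y s - P (\<eta> s) powr lam)"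
        unfolding cl
        by (intro continuous_intros continuous_on_subset[OF y(1) sub]
              continuous_on_compose2[OF P_cont] continuous_on_subset[OF \<eta>_cont sub])
           (use sub \<eta>_A P_pos in force)+
      show "y s - P (\<eta> s) powr lam = 0" if "s \<in> {0..<S}" for s
        using step(1)[OF _ before that] S t by simp
    qed (use cl \<open>0 < S\<close> in auto)
    moreover have "P (\<eta> S) > 0" using P_pos[OF \<eta>_A[of S]] S t by auto
    ultimately show False using S(3) by simp
  qed
  show thesis
  proof (rule that[of "\<lambda>t. y' t / y t"])
    show "P0_bar lam kap du0 \<rho>0 \<eta> t > 0" if "t \<in> {0..<T}" for t
      using P_pos \<eta>_A[OF that] by (simp add: P_eq)
    fix \<alpha> t assume \<alpha>: "\<alpha> \<in> {0..1::real}" and t: "t \<in> {0..<T}"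
    have yy: "(y t)\<^sup>2 = P (\<eta> t) powr (2 * lam)"
      using step(1)[OF order_refl y_pos t] by (simp add: powr_square)
    show "(\<phi> \<alpha> t)\<^sup>2 = P0_bar lam kap du0 \<rho>0 \<eta> t powr (2 * lam) * Q_fun lam kap du0 \<rho>0 \<eta> \<alpha> t"
      using step(2)[OF order_refl y_pos t \<alpha>] by (simp add: P_eq Q_eq yy)
    have "\<phi> \<alpha> t > 0" using pinney[OF \<alpha>] t by (auto simp: pinney_solution_def)
    then show "\<phi>' \<alpha> t / \<phi> \<alpha> t = y' t / y t
        - (lam * du0 \<alpha> - \<eta> t * C_coeff lam kap du0 \<rho>0 \<alpha>) / (\<phi> \<alpha> t)\<^sup>2"
      using step(3)[OF order_refl y_pos t \<alpha>] y_pos[OF t]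
      by (simp add: field_simps power2_eq_square)
  qed
qed

section \<open>Representation of the solution along characteristics\<close>

theorem mainTheorem1:
  fixes lam kap T :: real
    and u ux \<rho> \<gamma> :: "real \<Rightarrow> real \<Rightarrow> real"
    and u0 du0 \<rho>0 \<eta> :: "real \<Rightarrow> real"
  defines "C \<equiv> C_coeff lam kap du0 \<rho>0"
    and "Q \<equiv> Q_fun lam kap du0 \<rho>0 \<eta>"
    and "P0 \<equiv> P0_bar lam kap du0 \<rho>0 \<eta>"
  assumes "lam \<noteq> 0"
    and "classical_solution lam kap T u0 \<rho>0 u ux \<rho>"
    and "\<And>x. x \<in> {0..1} \<Longrightarrow> (u0 has_real_derivative du0 x) (at x within {0..1})"
    and "characteristic_map T u \<gamma>"
    and "strict_mono_on {0..<T} \<eta>"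
    and "\<eta> 0 = 0"
    and "\<And>t. t \<in> {0..<T} \<Longrightarrow>
           (\<eta> has_real_derivative P0 t powr (- 2 * lam)) (at t within {0..<T})"
    and "\<And>\<alpha> t. \<alpha> \<in> {0..1} \<Longrightarrow> t \<in> {0..<T} \<Longrightarrow> Q \<alpha> t > 0"
  shows "\<forall>t\<in>{0..<T}. \<forall>\<alpha>\<in>{0..1}.
     ((\<lambda>a. \<gamma> a t) has_real_derivative Q \<alpha> t powr (- 1 / (2 * lam)) / P0 t)
        (at \<alpha> within {0..1}) \<and>
     periodic_ext ux (\<gamma> \<alpha> t) t =
       P0 t powr (- 2 * lam) / lam *
         ((lam * du0 \<alpha> - \<eta> t * C \<alpha>) / Q \<alpha> t
          - 1 / P0 t * integral {0..1}
              (\<lambda>a. (lam * du0 a - \<eta> t * C a) / Q a t powr (1 + 1 / (2 * lam)))) \<and>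
     periodic_ext \<rho> (\<gamma> \<alpha> t) t =
       \<rho>0 \<alpha> / Q \<alpha> t * (integral {0..1} (\<lambda>a. 1 / Q a t powr (1 / (2 * lam)))) powr (- 2 * lam)"
proof (intro ballI)
  fix t \<alpha> :: real assume t: "t \<in> {0..<T}" and \<alpha>: "\<alpha> \<in> {0..1}"
  note sol = assms(5)[unfolded classical_solution_def] and init = assms(6)
    and char = assms(7)[unfolded characteristic_map_def]
  define U where "U = periodic_ext u"
  define V where "V = periodic_ext ux"
  define R where "R = periodic_ext \<rho>"
  obtain uxx uxt \<rho>x \<rho>t where second:
    "continuous_on ({0..1} \<times> {0<..<T}) (\<lambda>(x, t). uxx x t)"
    "continuous_on ({0..1} \<times> {0<..<T}) (\<lambda>(x, t). \<rho>x x t)"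
    "\<forall>t\<in>{0<..<T}. \<forall>x\<in>{0..1}.
       ((\<lambda>y. ux y t) has_real_derivative uxx x t) (at x within {0..1}) \<and>
       ((\<lambda>s. ux x s) has_real_derivative uxt x t) (at t) \<and>
       ((\<lambda>y. \<rho> y t) has_real_derivative \<rho>x x t) (at x within {0..1}) \<and>
       ((\<lambda>s. \<rho> x s) has_real_derivative \<rho>t x t) (at t) \<and>
       uxt x t + u x t * uxx x t - lam * (ux x t)\<^sup>2 - kap * (\<rho> x t)\<^sup>2
         = nonlocal_term lam kap ux \<rho> t \<and>
       \<rho>t x t + u x t * \<rho>x x t = 2 * lam * \<rho> x t * ux x t"
    using sol by blast
  have ux_cont: "continuous_on ({0..1} \<times> {0..<T}) (\<lambda>(x, t). ux x t)"
    and \<rho>_cont: "continuous_on ({0..1} \<times> {0..<T}) (\<lambda>(x, t). \<rho> x t)"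
    and ux: "\<forall>t\<in>{0..<T}. \<forall>x\<in>{0..1}. ((\<lambda>y. u y t) has_real_derivative ux x t) (at x within {0..1})"
    and initial: "\<forall>x\<in>{0..1}. u x 0 = u0 x \<and> \<rho> x 0 = \<rho>0 x"
    and periodic: "\<forall>t\<in>{0..<T}. u 0 t = u 1 t \<and> ux 0 t = ux 1 t \<and> \<rho> 0 t = \<rho> 1 t"
    using sol by blast+
  have lam: "lam \<noteq> 0" by fact
  have T0: "0 \<in> {0..<T}" using t by auto

  have V_cont: "continuous_on (UNIV \<times> {0..<T}) (\<lambda>(x, t). V x t)"
    and R_cont: "continuous_on (UNIV \<times> {0..<T}) (\<lambda>(x, t). R x t)"
    unfolding V_def R_def using periodic
    by (auto intro!: periodic_ext_continuous ux_cont \<rho>_cont)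
  have U_deriv: "((\<lambda>y. U y s) has_real_derivative V x s) (at x)" if "s \<in> {0..<T}" for x s
    unfolding U_def V_def
    by (rule periodic_ext_has_derivative) (use ux periodic that in auto)
  have \<gamma>: "(\<gamma> a has_real_derivative U (\<gamma> a s) s) (at s within {0..<T})"
    if "a \<in> {0..1}" "s \<in> {0..<T}" for a s
    using char that by (auto simp: U_def)
  have start: "\<gamma> a 0 = a" if "a \<in> {0..1}" for a using char that by auto
  have \<gamma>_cont: "continuous_on {0..<T} (\<gamma> a)" if "a \<in> {0..1}" for a
    by (rule DERIV_continuous_on[OF \<gamma>[OF that]])

  have du0: "du0 x = ux x 0" if "x \<in> {0..1}" for x
  proof -
    have "(u0 has_real_derivative ux x 0) (at x within {0..1})"
      by (rule has_field_derivative_transform_within[where f = "\<lambda>y. u y 0" and d = 1])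
         (use ux T0 initial that in auto)
    then show ?thesis
      using init[OF that] that vector_derivative_unique_within_closed_interval[of 0 1 x u0]
      by (simp add: has_real_derivative_iff_has_vector_derivative)
  qed
  have at_0: "continuous_on {0..1} ((\<lambda>(x, t). ux x t) \<circ> (\<lambda>x. (x, 0)))"
    "continuous_on {0..1} ((\<lambda>(x, t). \<rho> x t) \<circ> (\<lambda>x. (x, 0)))"
    by (intro continuous_on_compose continuous_intros continuous_on_subset[OF ux_cont]
          continuous_on_subset[OF \<rho>_cont]; use T0 in auto)+
  have du0_cont: "continuous_on {0..1} du0"
    by (rule continuous_on_eq[OF at_0(1)]) (use du0 in simp)
  have \<rho>0_cont: "continuous_on {0..1} \<rho>0"
    by (rule continuous_on_eq[OF at_0(2)]) (use initial in simp)

  define w where "w a s = V (\<gamma> a s) s" for a s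
  define r where "r a s = R (\<gamma> a s) s" for a s
  have w_cont: "continuous_on {0..<T} (w a)" and r_cont: "continuous_on {0..<T} (r a)"
    if "a \<in> {0..1}" for a
  proof -
    have "continuous_on {0..<T} ((\<lambda>(x, t). V x t) \<circ> (\<lambda>s. (\<gamma> a s, s)))"
      "continuous_on {0..<T} ((\<lambda>(x, t). R x t) \<circ> (\<lambda>s. (\<gamma> a s, s)))"
      by (intro continuous_on_compose continuous_intros \<gamma>_cont[OF that]
            continuous_on_subset[OF V_cont] continuous_on_subset[OF R_cont]; auto)+
    then show "continuous_on {0..<T} (w a)" "continuous_on {0..<T} (r a)"
      by (simp_all add: w_def[abs_def] r_def[abs_def] o_def)
  qed
  have \<gamma>_at: "(\<gamma> a has_real_derivative U (\<gamma> a s) s) (at s)"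
    if "a \<in> {0..1}" "s \<in> {0<..<T}" for a s
    using \<gamma>[OF that(1), of s] that(2) by (simp add: at_within_half_open_eq_at)
  have w': "(w a has_real_derivative
      lam * (w a s)\<^sup>2 + kap * (r a s)\<^sup>2 + nonlocal_term lam kap ux \<rho> s) (at s)"
    if "a \<in> {0..1}" "s \<in> {0<..<T}" for a s
  proof -
    let ?R = "\<lambda>x s. lam * (ux x s)\<^sup>2 + kap * (\<rho> x s)\<^sup>2 + nonlocal_term lam kap ux \<rho> s"
    have "((\<lambda>s. periodic_ext ux (\<gamma> a s) s) has_real_derivative periodic_ext ?R (\<gamma> a s) s) (at s)"
    proof (rule periodic_ext_along_curve[where T = T and fx = uxx and ft = uxt and u = u])
      show "uxt x s + u x s * uxx x s = ?R x s" if "x \<in> {0..1}" "s \<in> {0<..<T}" for x s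
        using second(3)[rule_format, OF that(2,1)] by linarith
    qed (use second periodic that \<gamma>_at in \<open>auto simp: U_def\<close>)
    then show ?thesis by (simp add: w_def[abs_def] r_def V_def R_def periodic_ext_def)
  qed
  have r': "(r a has_real_derivative 2 * lam * r a s * w a s) (at s)"
    if "a \<in> {0..1}" "s \<in> {0<..<T}" for a s
  proof -
    let ?R = "\<lambda>x s. 2 * lam * \<rho> x s * ux x s"
    have "((\<lambda>s. periodic_ext \<rho> (\<gamma> a s) s) has_real_derivative periodic_ext ?R (\<gamma> a s) s) (at s)"
    proof (rule periodic_ext_along_curve[where T = T and fx = \<rho>x and ft = \<rho>t and u = u])
      show "\<rho>t x s + u x s * \<rho>x x s = ?R x s" if "x \<in> {0..1}" "s \<in> {0<..<T}" for x s
        using second(3)[rule_format, OF that(2,1)] by linarith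
    qed (use second periodic that \<gamma>_at in \<open>auto simp: U_def\<close>)
    then show ?thesis by (simp add: w_def r_def[abs_def] V_def R_def periodic_ext_def)
  qed

  \<comment> \<open>\<open>\<phi>\<close> is \<open>J powr (-lam)\<close>, written through \<open>w\<close> because \<open>J\<close> is not yet known to be \<open>exp (\<integral>w)\<close>.\<close>
  define \<phi> where "\<phi> a s = exp (- lam * integral {0..s} (w a))" for a s
  define \<phi>' where "\<phi>' a s = - lam * w a s * \<phi> a s" for a s
  have \<phi>_within: "(\<phi> a has_real_derivative \<phi>' a s) (at s within {0..<T})"
    if "a \<in> {0..1}" "s \<in> {0..<T}" for a s
    unfolding \<phi>_def \<phi>'_def
    by (rule derivative_eq_intros has_real_derivative_integral_half_open[OF w_cont] that refl)+ simp
  have \<phi>_at: "(\<phi> a has_real_derivative \<phi>' a s) (at s)"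
    if "a \<in> {0..1}" "s \<in> {0<..<T}" for a s
    using \<phi>_within[OF that(1), of s] that(2) by (simp add: at_within_half_open_eq_at)
  have \<phi>_cont: "continuous_on {0..<T} (\<phi> a)" if "a \<in> {0..1}" for a
    by (rule DERIV_continuous_on[OF \<phi>_within[OF that]])
  have \<phi>_pos: "\<phi> a s > 0" for a s by (simp add: \<phi>_def)
  have \<phi>0: "\<phi> a 0 = 1" for a by (simp add: \<phi>_def)
  have r0: "r a 0 = \<rho>0 a" and w0: "w a 0 = du0 a" if "a \<in> {0..1}" for a
    using that bspec[OF initial that] du0[OF that] bspec[OF periodic T0] start[OF that]
      periodic_ext_unit_interval[of \<rho> 0 a] periodic_ext_unit_interval[of ux 0 a]
    by (simp_all add: r_def w_def R_def V_def)
  have r_eq: "r a s = \<rho>0 a / (\<phi> a s)\<^sup>2" if "a \<in> {0..1}" "s \<in> {0..<T}" for a s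
  proof -
    have "r a s * (\<phi> a s * \<phi> a s) = r a 0 * (\<phi> a 0 * \<phi> a 0)"
    proof (rule has_real_derivative_0_imp_const[OF _ _ that(2)])
      show "continuous_on {0..<T} (\<lambda>s. r a s * (\<phi> a s * \<phi> a s))"
        by (intro continuous_intros r_cont \<phi>_cont that(1))
      show "((\<lambda>s. r a s * (\<phi> a s * \<phi> a s)) has_real_derivative 0) (at s)" if s: "s \<in> {0<..<T}" for s
        by (rule DERIV_cong[OF DERIV_mult[OF r' DERIV_mult[OF \<phi>_at \<phi>_at]]])
           (use s \<open>a \<in> {0..1}\<close> in \<open>simp_all add: \<phi>'_def algebra_simps\<close>)
    qed
    then show ?thesis using \<phi>_pos[of a s] by (simp add: \<phi>0 r0[OF that(1)] field_simps power2_eq_square)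
  qed
  have pinney: "pinney_solution T (\<lambda>s. lam * nonlocal_term lam kap ux \<rho> s) (lam * kap * (\<rho>0 a)\<^sup>2)
      (\<phi> a) (\<phi>' a)" if a: "a \<in> {0..1}" for a
    unfolding pinney_solution_def
  proof (intro conjI ballI)
    show "continuous_on {0..<T} (\<phi>' a)"
      unfolding \<phi>'_def by (intro continuous_intros w_cont \<phi>_cont a)
    fix s assume s: "s \<in> {0<..<T}"
    have "(\<phi>' a has_real_derivative
        (- lam * (lam * (w a s)\<^sup>2 + kap * (r a s)\<^sup>2 + nonlocal_term lam kap ux \<rho> s)) * \<phi> a s
        + \<phi>' a s * (- lam * w a s)) (at s)"
      unfolding \<phi>'_def[of a, abs_def]
      by (rule DERIV_cong[OF DERIV_mult[OF DERIV_cmult[OF w'[OF a s]] \<phi>_at[OF a s]]])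
         (simp add: \<phi>'_def)
    moreover have "(- lam * (lam * (w a s)\<^sup>2 + kap * (r a s)\<^sup>2 + nonlocal_term lam kap ux \<rho> s)) * \<phi> a s
        + \<phi>' a s * (- lam * w a s)
        = - (lam * nonlocal_term lam kap ux \<rho> s) * \<phi> a s - lam * kap * (r a s)\<^sup>2 * \<phi> a s"
      by (simp add: \<phi>'_def algebra_simps power2_eq_square)
    moreover have "lam * kap * (r a s)\<^sup>2 * \<phi> a s = lam * kap * (\<rho>0 a)\<^sup>2 / \<phi> a s ^ 3"
      using r_eq[OF a, of s] s \<phi>_pos[of a s]
      by (simp add: field_simps power2_eq_square power3_eq_cube)
    ultimately show "(\<phi>' a has_real_derivative
        - (lam * nonlocal_term lam kap ux \<rho> s) * \<phi> a s - lam * kap * (\<rho>0 a)\<^sup>2 / \<phi> a s ^ 3) (at s)"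
      by simp
  qed (use a in \<open>auto intro: \<phi>_cont \<phi>_at simp: \<phi>0 \<phi>_pos\<close>)

  define J where "J a s = \<phi> a s powr (- 1 / lam)" for a s
  have J_deriv: "((\<lambda>a. \<gamma> a s) has_real_derivative J a s) (at a within {0..1})"
    if a: "a \<in> {0..1}" and s: "s \<in> {0..<T}" for a s
  proof -
    have sub: "{0..1} \<times> {0..s} \<subseteq> {0..1} \<times> {0..<T}" using s by auto
    have "compact ((\<lambda>(x, t). ux x t) ` ({0..1} \<times> {0..s}))"
      by (intro compact_continuous_image continuous_on_subset[OF ux_cont sub] compact_Times) auto
    from compact_imp_bounded[OF this]
    obtain M where M: "\<And>x q. x \<in> {0..1} \<Longrightarrow> q \<in> {0..s} \<Longrightarrow> \<bar>ux x q\<bar> \<le> M"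
      by (force simp: bounded_real)
    have "V x q \<le> M" if "q \<in> {0..s}" for x q
      using M[of "frac x" q] that frac_lt_1[of x] by (auto simp: V_def periodic_ext_def)
    from flow_has_derivative[OF V_cont U_deriv this start \<gamma> s a]
    have "((\<lambda>a. \<gamma> a s) has_real_derivative exp (integral {0..s} (w a))) (at a within {0..1})"
      by (simp add: w_def[abs_def])
    then show ?thesis using lam by (simp add: J_def \<phi>_def powr_def)
  qed
  \<comment> \<open>Both sides are trajectories of the periodic velocity field starting at \<open>1\<close>.\<close>
  have period: "\<gamma> 1 s = \<gamma> 0 s + 1" if "s \<in> {0..<T}" for s
  proof -
    have "((\<lambda>s. \<gamma> 0 s + 1) has_real_derivative U (\<gamma> 0 s + 1) s) (at s within {0..<T})"
      if "s \<in> {0..<T}" for s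
      using DERIV_add[OF \<gamma>[of 0, OF _ that] DERIV_const[of 1]]
      by (simp add: U_def periodic_ext_add_1)
    from trajectories_difference[OF V_cont U_deriv this \<gamma>[of 1], of s] that
    show ?thesis by (simp add: start)
  qed
  have mass: "(( \<lambda>a. J a s) has_integral 1) {0..1}" if "s \<in> {0..<T}" for s
    using fundamental_theorem_of_calculus[of 0 1 "\<lambda>a. \<gamma> a s" "\<lambda>a. J a s"] J_deriv[OF _ that]
    by (simp add: period[OF that] has_real_derivative_iff_has_vector_derivative)
  \<comment> \<open>\<open>w J\<close> is the \<open>\<alpha>\<close>-derivative of \<open>u(\<gamma>(\<alpha>,s),s)\<close>, which takes equal values at \<open>0\<close> and \<open>1\<close>.\<close>
  have no_flux: "((\<lambda>a. w a s * J a s) has_integral 0) {0..1}" if "s \<in> {0..<T}" for s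
  proof -
    have "((\<lambda>a. U (\<gamma> a s) s) has_vector_derivative w a s * J a s) (at a within {0..1})"
      if "a \<in> {0..1}" for a
      unfolding has_real_derivative_iff_has_vector_derivative[symmetric] w_def
      by (rule DERIV_chain2[OF U_deriv J_deriv]) (use that \<open>s \<in> {0..<T}\<close> in auto)
    from fundamental_theorem_of_calculus[OF _ this] show ?thesis
      by (simp add: period[OF that] U_def periodic_ext_add_1)
  qed

  have mass_\<phi>: "integral {0..1} (\<lambda>a. \<phi> a s powr (- 1 / lam)) = 1" if "s \<in> {0..<T}" for s
    using mass[OF that] by (simp add: J_def integral_unique)
  have slope0: "\<phi>' a 0 = - lam * du0 a" if "a \<in> {0..1}" for a
    by (simp add: \<phi>'_def w0[OF that] \<phi>0)
  note closed_form = pinney_family_closed_form[where \<phi> = \<phi> and \<phi>' = \<phi>' and \<eta> = \<eta> and T = T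
      and lam = lam and kap = kap and ?du0.0 = du0 and ?\<rho>0.0 = \<rho>0, folded P0_def Q_def C_def,
      OF lam du0_cont \<rho>0_cont pinney slope0 mass_\<phi> assms(9-11)]
  obtain Y where P0_pos: "P0 t > 0"
    and \<phi>_sq: "\<And>a. a \<in> {0..1} \<Longrightarrow> (\<phi> a t)\<^sup>2 = P0 t powr (2 * lam) * Q a t"
    and \<phi>_log: "\<And>a. a \<in> {0..1} \<Longrightarrow> \<phi>' a t / \<phi> a t = Y t - (lam * du0 a - \<eta> t * C a) / (\<phi> a t)\<^sup>2"
    by (rule closed_form) (use t in blast)+
  have Q_pos: "Q a t > 0" if "a \<in> {0..1}" for a using assms(11) that t by blast
  have J_eq: "J a t = Q a t powr (- 1 / (2 * lam)) / P0 t" if "a \<in> {0..1}" for a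
  proof -
    have "J a t = ((\<phi> a t)\<^sup>2) powr (- 1 / (2 * lam))"
      by (simp add: J_def square_powr[OF \<phi>_pos])
    also have "\<dots> = P0 t powr (-1) * Q a t powr (- 1 / (2 * lam))"
      using Q_pos[OF that] P0_pos lam by (simp add: \<phi>_sq[OF that] powr_mult powr_powr less_imp_le)
    finally show ?thesis using P0_pos by (simp add: powr_minus_divide)
  qed
  define N where "N a = lam * du0 a - \<eta> t * C a" for a
  define p where "p = P0 t powr (- 2 * lam)"
  have p: "P0 t powr (2 * lam) = 1 / p" "p > 0"
    using P0_pos by (simp_all add: p_def powr_minus_divide)
  have w_eq: "w a t = p / lam * (N a / Q a t) - Y t / lam" if "a \<in> {0..1}" for a
  proof -
    have "- lam * w a t = Y t - N a / (\<phi> a t)\<^sup>2"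
      using \<phi>_log[OF that] \<phi>_pos[of a t] by (simp add: \<phi>'_def N_def)
    also have "N a / (\<phi> a t)\<^sup>2 = p * (N a / Q a t)" by (simp add: \<phi>_sq[OF that] p)
    finally show ?thesis using lam by (simp add: field_simps)
  qed
  define K where "K = integral {0..1} (\<lambda>a. N a / Q a t powr (1 + 1 / (2 * lam)))"
  have "continuous_on {0..1} (\<lambda>a. N a / Q a t powr (1 + 1 / (2 * lam)))"
    unfolding N_def C_def Q_def Q_fun_def C_coeff_def
    by (intro continuous_intros du0_cont \<rho>0_cont)
       (use Q_pos in \<open>force simp: Q_def Q_fun_def C_coeff_def\<close>)+
  then have K: "((\<lambda>a. N a / Q a t powr (1 + 1 / (2 * lam))) has_integral K) {0..1}"
    unfolding K_def by (intro integrable_integral integrable_continuous_real)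
  \<comment> \<open>Inserting the closed forms into \<open>\<integral>w J = 0\<close> leaves one linear equation for \<open>Y t\<close>.\<close>
  have split_int: "((\<lambda>a. p / (lam * P0 t) * (N a / Q a t powr (1 + 1 / (2 * lam))) - Y t / lam * J a t)
      has_integral (p / (lam * P0 t) * K - Y t / lam * 1)) {0..1}"
    by (intro has_integral_diff has_integral_mult_right K mass t)
  have split_eq: "p / (lam * P0 t) * (N a / Q a t powr (1 + 1 / (2 * lam))) - Y t / lam * J a t
      = w a t * J a t" if "a \<in> {0..1}" for a
  proof -
    have "Q a t powr (1 + 1 / (2 * lam)) = Q a t * Q a t powr (1 / (2 * lam))"
      using Q_pos[OF that] by (simp add: powr_add)
    moreover have "J a t = 1 / (Q a t powr (1 / (2 * lam)) * P0 t)"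
      using Q_pos[OF that] by (simp add: J_eq[OF that] powr_minus_divide)
    ultimately show ?thesis
      unfolding w_eq[OF that] by (simp add: left_diff_distrib diff_divide_distrib mult.assoc mult.left_commute)
  qed
  have "((\<lambda>a. w a t * J a t) has_integral (p / (lam * P0 t) * K - Y t / lam * 1)) {0..1}"
    by (rule has_integral_eq[OF split_eq split_int])
  from has_integral_unique[OF this no_flux[OF t]]
  have Y: "Y t = p * (1 / P0 t * K)" using lam by (simp add: field_simps)
  have P0_alt: "integral {0..1} (\<lambda>a. 1 / Q a t powr (1 / (2 * lam))) = P0 t"
    unfolding P0_def P0_bar_def
    by (rule integral_cong) (use Q_pos in \<open>simp add: powr_minus_divide Q_def\<close>)
  show "((\<lambda>a. \<gamma> a t) has_real_derivative Q \<alpha> t powr (- 1 / (2 * lam)) / P0 t)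
        (at \<alpha> within {0..1}) \<and>
     periodic_ext ux (\<gamma> \<alpha> t) t =
       P0 t powr (- 2 * lam) / lam *
         ((lam * du0 \<alpha> - \<eta> t * C \<alpha>) / Q \<alpha> t
          - 1 / P0 t * integral {0..1}
              (\<lambda>a. (lam * du0 a - \<eta> t * C a) / Q a t powr (1 + 1 / (2 * lam)))) \<and>
     periodic_ext \<rho> (\<gamma> \<alpha> t) t =
       \<rho>0 \<alpha> / Q \<alpha> t * (integral {0..1} (\<lambda>a. 1 / Q a t powr (1 / (2 * lam)))) powr (- 2 * lam)"
  proof (intro conjI)
    show "((\<lambda>a. \<gamma> a t) has_real_derivative Q \<alpha> t powr (- 1 / (2 * lam)) / P0 t) (at \<alpha> within {0..1})"
      using J_deriv[OF \<alpha> t] by (simp only: J_eq[OF \<alpha>])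
    have "w \<alpha> t = p / lam * (N \<alpha> / Q \<alpha> t - 1 / P0 t * K)"
      unfolding w_eq[OF \<alpha>] Y by (simp add: algebra_simps)
    then show "periodic_ext ux (\<gamma> \<alpha> t) t = P0 t powr (- 2 * lam) / lam *
         ((lam * du0 \<alpha> - \<eta> t * C \<alpha>) / Q \<alpha> t
          - 1 / P0 t * integral {0..1}
              (\<lambda>a. (lam * du0 a - \<eta> t * C a) / Q a t powr (1 + 1 / (2 * lam))))"
      by (simp only: w_def V_def p_def N_def K_def)
    have "r \<alpha> t = \<rho>0 \<alpha> / Q \<alpha> t * p"
      unfolding r_eq[OF \<alpha> t] \<phi>_sq[OF \<alpha>] p(1) by simp
    then show "periodic_ext \<rho> (\<gamma> \<alpha> t) t =
       \<rho>0 \<alpha> / Q \<alpha> t * (integral {0..1} (\<lambda>a. 1 / Q a t powr (1 / (2 * lam)))) powr (- 2 * lam)"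
      unfolding P0_alt by (simp only: r_def R_def p_def)
  qed
qed

end
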